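(* Let $n\geq 1$, let $X$ be a path-connected CW complex of dimension $n$, let $Y$ be a path-connected topological manifold of dimension $n+1$, and let $\tau:X\to X$ be a fixed-point free cellular involution. Then the triple $\left((X,\tau);Y\right)$ does not satisfy the Borsuk-Ulam property (BUP).
   Context: The triple $\left((X,\tau);Y\right)$ satisfies the Borsuk-Ulam property (BUP) if for every continuous map $f:X\to Y$ there exists $x\in X$ with $f(\tau(x))=f(x)$. *)

theory Defs
  imports "HOL-Analysis.Analysis"
begin

definition disc_set :: "nat \<Rightarrow> (nat \<Rightarrow> real) set" where
  "disc_set k = {x \<in> topspace (Euclidean_space k). (\<Sum>i<k. (x i)\<^sup>2) \<le> 1}"

definition open_disc_set :: "nat \<Rightarrow> (nat \<Rightarrow> real) set" where
  "open_disc_set k = {x \<in> topspace (Euclidean_space k). (\<Sum>i<k. (x i)\<^sup>2) < 1}"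

text \<open>For \<open>k = 0\<close> the disc and the open disc are the same single point, and the
  boundary sphere is empty.\<close>

definition disc_boundary :: "nat \<Rightarrow> (nat \<Rightarrow> real) set" where
  "disc_boundary k = {x \<in> topspace (Euclidean_space k). (\<Sum>i<k. (x i)\<^sup>2) = 1}"

definition characteristic_map ::
    "'a topology \<Rightarrow> (nat \<Rightarrow> 'a set set) \<Rightarrow> nat \<Rightarrow> 'a set \<Rightarrow> ((nat \<Rightarrow> real) \<Rightarrow> 'a) \<Rightarrow> bool" where
  "characteristic_map X E k e \<phi> \<longleftrightarrow>
     continuous_map (subtopology (Euclidean_space k) (disc_set k)) X \<phi> \<and>
     homeomorphic_map (subtopology (Euclidean_space k) (open_disc_set k)) (subtopology X e) \<phi> \<and>
     (\<exists>F. finite F \<and> F \<subseteq> (\<Union>j<k. E j) \<and> \<phi> ` disc_boundary k \<subseteq> \<Union>F)"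

text \<open>A CW structure (in the sense of Whitehead) on the space \<open>X\<close>: the set \<open>E k\<close> consists
  of the open \<open>k\<close>-cells, as subsets of \<open>X\<close>. There may be infinitely many cells. Closure
  finiteness is the last clause of \<open>characteristic_map\<close>; the last clause here says that \<open>X\<close>
  carries the weak topology, the converse implication being automatic.\<close>

definition CW_complex :: "'a topology \<Rightarrow> (nat \<Rightarrow> 'a set set) \<Rightarrow> bool" where
  "CW_complex X E \<longleftrightarrow>
     Hausdorff_space X \<and>
     (\<Union>k. \<Union>(E k)) = topspace X \<and>
     (\<forall>k l. \<forall>e\<in>E k. \<forall>e'\<in>E l. e \<inter> e' \<noteq> {} \<longrightarrow> k = l \<and> e = e') \<and>
     (\<forall>k. \<forall>e\<in>E k. \<exists>\<phi>. characteristic_map X E k e \<phi>) \<and>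
     (\<forall>A. A \<subseteq> topspace X \<longrightarrow>
        (\<forall>k. \<forall>e\<in>E k. closedin X (A \<inter> X closure_of e)) \<longrightarrow> closedin X A)"

definition CW_dimension :: "(nat \<Rightarrow> 'a set set) \<Rightarrow> nat \<Rightarrow> bool" where
  "CW_dimension E n \<longleftrightarrow> E n \<noteq> {} \<and> (\<forall>k>n. E k = {})"

definition skeleton :: "(nat \<Rightarrow> 'a set set) \<Rightarrow> nat \<Rightarrow> 'a set" where
  "skeleton E k = (\<Union>j\<le>k. \<Union>(E j))"

definition cellular_map ::
    "'a topology \<Rightarrow> (nat \<Rightarrow> 'a set set) \<Rightarrow> 'b topology \<Rightarrow> (nat \<Rightarrow> 'b set set) \<Rightarrow> ('a \<Rightarrow> 'b) \<Rightarrow> bool" where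
  "cellular_map X E X' E' g \<longleftrightarrow>
     continuous_map X X' g \<and> (\<forall>k. g ` skeleton E k \<subseteq> skeleton E' k)"

definition involution_on :: "'a topology \<Rightarrow> ('a \<Rightarrow> 'a) \<Rightarrow> bool" where
  "involution_on X \<tau> \<longleftrightarrow>
     continuous_map X X \<tau> \<and> (\<forall>x\<in>topspace X. \<tau> (\<tau> x) = x)"

text \<open>Manifolds are Hausdorff, second countable and without boundary. The empty space is
  not excluded here.\<close>

definition topological_manifold :: "nat \<Rightarrow> 'a topology \<Rightarrow> bool" where
  "topological_manifold m Y \<longleftrightarrow>
     Hausdorff_space Y \<and> second_countable Y \<and>
     (\<forall>y\<in>topspace Y. \<exists>U V. openin Y U \<and> y \<in> U \<and> openin (Euclidean_space m) V \<and>
        subtopology Y U homeomorphic_space subtopology (Euclidean_space m) V)"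

definition borsuk_ulam_property :: "'a topology \<Rightarrow> ('a \<Rightarrow> 'a) \<Rightarrow> 'b topology \<Rightarrow> bool" where
  "borsuk_ulam_property X \<tau> Y \<longleftrightarrow>
     (\<forall>f. continuous_map X Y f \<longrightarrow> (\<exists>x\<in>topspace X. f (\<tau> x) = f x))"

end

theory Submission
  imports Defs
begin

text \<open>It suffices to find continuous \<open>F 0, \<dots>, F n\<close> on \<open>X\<close> without common zero such that
  \<open>F s \<circ> \<tau> = - F s\<close>: after clamping and shrinking, the tuple \<open>(F 0, \<dots>, F n)\<close> is an odd map into
  a cube in the image of a chart of \<open>Y\<close>, with the centre of the cube as origin, and an odd vector
  that agrees with its negative is zero.

  The tuple is built over the skeleta. The involution permutes the open cells, as it preserves the
  skeleta and the \<open>k\<close>-cells are the components of the \<open>k\<close>-skeleton minus the \<open>(k-1)\<close>-skeleton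
  (\<open>involution_permutes_cells\<close>). So it is enough to extend over the closure of a single orbit
  \<open>e \<union> \<tau> ` e\<close>, which is compact Hausdorff (\<open>odd_extension_over_orbit\<close>), and the weak topology
  takes care of continuity on \<open>X\<close>. That a fixed-point free involution cannot map a cell onto itself
  is a fact of Smith theory; the extension argument treats the cases \<open>\<tau> ` e = e\<close> and
  \<open>\<tau> ` e \<noteq> e\<close> alike, by general position.

  Namely, Tietze's theorem and antisymmetrization extend the tuple to an odd one that may vanish
  somewhere in the open cells. Its zeros are removed on one small patch \<open>C\<close> after the other, where
  \<open>C\<close> is disjoint from \<open>\<tau> ` C\<close>: any change \<open>d\<close> of the tuple on \<open>C\<close> can be matched by
  \<open>- d \<circ> \<tau>\<close> on \<open>\<tau> ` C\<close> (\<open>odd_perturbation_on_patch\<close>, \<open>odd_extension\<close>). The change comes from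
  the fact that on a compact subset of a \<open>k\<close>-dimensional space any \<open>m > k\<close> functions are close to
  functions without common zero (\<open>approximate_without_common_zero\<close>). Its proof uses the
  \<open>m\<close> shifted grids known from Kolmogorov's superposition theorem: every point lies well inside a
  cube of one of the grids, and well inside the cubes of the \<open>s\<close>-th grid the \<open>s\<close>-th function can
  be replaced by nonzero constants, one for each cube.\<close>

section \<open>General position on a compact set of small dimension\<close>

lemma continuous_positive_bounded_below:
  assumes "compactin X K" and "continuous_map (subtopology X K) euclideanreal g"
    and "\<And>x. x \<in> K \<Longrightarrow> g x > 0"
  shows "\<exists>\<delta>>0. \<forall>x\<in>K. \<delta> \<le> g x"
proof (cases "K = {}")
  case True
  then show ?thesis by (auto intro: exI[of _ 1])
next
  case False
  have "compactin (subtopology X K) K"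
    using assms(1) by (simp add: compactin_subtopology)
  then have "compactin euclideanreal (g ` K)"
    using assms(2) image_compactin by blast
  then have "compact (g ` K)" by simp
  then obtain s where "s \<in> g ` K" "\<forall>t\<in>g ` K. s \<le> t"
    using compact_attains_inf[of "g ` K"] False by auto
  then show ?thesis using assms(3) by (intro exI[of _ s]) auto
qed

text \<open>The functions \<open>u i\<close> serve as coordinates, and this is uniform continuity with respect to them.
  The compact set of pairs at which some \<open>f s\<close> varies by a definite amount misses the diagonal, so
  the coordinate distance is bounded away from \<open>0\<close> on it.\<close>

lemma separating_functions_modulus:
  fixes u f :: "nat \<Rightarrow> 'a \<Rightarrow> real"
  assumes C: "compact_space C"
    and u: "\<And>i. i < k \<Longrightarrow> continuous_map C euclideanreal (u i)"
    and sep: "\<And>x y. \<lbrakk>x \<in> topspace C; y \<in> topspace C; \<And>i. i < k \<Longrightarrow> u i x = u i y\<rbrakk> \<Longrightarrow> x = y"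
    and f: "\<And>s. s < m \<Longrightarrow> continuous_map C euclideanreal (f s)"
    and "\<epsilon> > 0"
  shows "\<exists>\<delta>>0. \<forall>x\<in>topspace C. \<forall>y\<in>topspace C.
    (\<forall>i<k. \<bar>u i x - u i y\<bar> < \<delta>) \<longrightarrow> (\<forall>s<m. \<bar>f s x - f s y\<bar> < \<epsilon>)"
proof -
  let ?P = "prod_topology C C"
  have fst: "continuous_map ?P euclideanreal (\<lambda>p. h (fst p))"
    and snd: "continuous_map ?P euclideanreal (\<lambda>p. h (snd p))"
    if "continuous_map C euclideanreal h" for h
    using continuous_map_compose[OF continuous_map_fst that]
      continuous_map_compose[OF continuous_map_snd that] by (auto simp: o_def)
  define D where "D = (\<lambda>p. \<Sum>i<k. \<bar>u i (fst p) - u i (snd p)\<bar>)"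
  define W where "W = (\<lambda>p. \<Sum>s<m. \<bar>f s (fst p) - f s (snd p)\<bar>)"
  have cD: "continuous_map ?P euclideanreal D" and cW: "continuous_map ?P euclideanreal W"
    unfolding D_def W_def
    by (intro continuous_map_sum continuous_map_real_abs continuous_map_diff fst snd u f; simp)+
  define K where "K = {p \<in> topspace ?P. W p \<in> {\<epsilon>..}}"
  have "closedin ?P K"
    unfolding K_def by (rule closedin_continuous_map_preimage[OF cW]) auto
  then have K: "compactin ?P K"
    using C by (simp add: closedin_compact_space compact_space_prod_topology)
  have "D p > 0" if "p \<in> K" for p
  proof -
    have "D p \<ge> 0" by (simp add: D_def sum_nonneg)
    moreover have "D p \<noteq> 0"
    proof
      assume "D p = 0"
      then have "\<forall>i<k. u i (fst p) = u i (snd p)"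
        by (simp add: D_def sum_nonneg_eq_0_iff)
      then have "fst p = snd p"
        using that by (intro sep) (auto simp: K_def mem_Times_iff)
      then have "W p = 0" by (simp add: W_def)
      then show False using that \<open>\<epsilon> > 0\<close> by (simp add: K_def)
    qed
    ultimately show ?thesis by linarith
  qed
  from continuous_positive_bounded_below[OF K continuous_map_from_subtopology[OF cD] this]
  obtain d where d: "d > 0" "\<And>p. p \<in> K \<Longrightarrow> d \<le> D p" by blast
  show ?thesis
  proof (intro exI[of _ "d / (k + 1)"] conjI ballI impI allI)
    fix x y s assume xy: "x \<in> topspace C" "y \<in> topspace C"
      and near: "\<forall>i<k. \<bar>u i x - u i y\<bar> < d / (k + 1)" and "s < m"
    have "D (x, y) \<le> (\<Sum>i<k. d / (k + 1))"
      unfolding D_def using near by (intro sum_mono) (auto intro: less_imp_le)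
    also have "\<dots> < d" using d(1) by (simp add: field_simps)
    finally have "(x, y) \<notin> K" using d(2) by force
    then have "W (x, y) < \<epsilon>" using xy by (simp add: K_def)
    moreover have "\<bar>f s x - f s y\<bar> \<le> W (x, y)"
      unfolding W_def using \<open>s < m\<close> member_le_sum[of s "{..<m}" "\<lambda>s. \<bar>f s x - f s y\<bar>"] by simp
    ultimately show "\<bar>f s x - f s y\<bar> < \<epsilon>" by linarith
  qed (use d in simp)
qed

lemma continuous_map_locally_constant:
  assumes "\<And>x. x \<in> topspace X \<Longrightarrow> \<exists>U. openin X U \<and> x \<in> U \<and> (\<forall>y\<in>U. h y = h x)"
  shows "continuous_map X euclidean h"
  unfolding continuous_map
proof (intro conjI allI impI)
  fix V :: "'b set"
  show "openin X {x \<in> topspace X. h x \<in> V}"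
  proof (rule iffD2[OF openin_subopen], intro ballI)
    fix x assume x: "x \<in> {x \<in> topspace X. h x \<in> V}"
    then have "x \<in> topspace X" by simp
    from assms[OF this] obtain U where U: "openin X U" "x \<in> U" "\<forall>y\<in>U. h y = h x"
      by (elim exE conjE)
    have "U \<subseteq> {x \<in> topspace X. h x \<in> V}"
    proof
      fix y assume "y \<in> U"
      then have "h y = h x" using U(3) by blast
      then show "y \<in> {x \<in> topspace X. h x \<in> V}"
        using \<open>y \<in> U\<close> U(1) x openin_subset by fastforce
    qed
    with U(1,2) show "\<exists>U. openin X U \<and> x \<in> U \<and> U \<subseteq> {x \<in> topspace X. h x \<in> V}"
      by blast
  qed
qed simp

text \<open>The points \<open>a\<close> and \<open>b\<close> keep distance \<open>1/2\<close> from the grid \<open>s + m \<int>\<close>. If a grid point separated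
  them, they would be at distance at least \<open>1\<close>.\<close>

lemma shifted_grid_floor_eq:
  fixes a b :: real and m s :: nat
  assumes "m > 0" and near: "\<bar>a - b\<bar> < 1"
    and a: "\<And>z::int. \<bar>a - (real s + real m * of_int z)\<bar> \<ge> 1/2" and b: "\<And>z::int. \<bar>b - (real s + real m * of_int z)\<bar> \<ge> 1/2"
  shows "\<lfloor>(a - s) / m\<rfloor> = \<lfloor>(b - s) / m\<rfloor>"
proof -
  have *: "\<lfloor>(b - s) / m\<rfloor> \<le> \<lfloor>(a - s) / m\<rfloor>"
    if near: "\<bar>a - b\<bar> < 1" and a: "\<And>z::int. \<bar>a - (real s + real m * of_int z)\<bar> \<ge> 1/2"
      and b: "\<And>z::int. \<bar>b - (real s + real m * of_int z)\<bar> \<ge> 1/2" for a b :: real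
  proof (rule ccontr)
    assume "\<not> ?thesis"
    then have "(a - s) / m < \<lfloor>(b - s) / m\<rfloor>"
      by (metis floor_less_iff not_le)
    then obtain q :: int where q: "(a - s) / m < q" "q \<le> (b - s) / m"
      using of_int_floor_le by blast
    then have "a < s + m * real_of_int q" "s + m * real_of_int q \<le> b"
      using \<open>m > 0\<close> by (simp_all add: field_simps)
    then show False using a[of q] b[of q] near by linarith
  qed
  show ?thesis
    using *[OF near a b] *[of b a] near a b by (simp add: abs_minus_commute)
qed

text \<open>A real number is within distance less than \<open>1/2\<close> of at most one integer, so it is close to at
  most one of the \<open>m\<close> grids \<open>s + m \<int>\<close>. The \<open>k < m\<close> coordinates therefore spoil at most \<open>k\<close> of
  the shifts \<open>s\<close>.\<close>

lemma exists_good_shift: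
  fixes t :: "nat \<Rightarrow> real"
  assumes "k < m"
  shows "\<exists>s<m. \<forall>i<k. \<forall>z::int. \<bar>t i - (real s + real m * z)\<bar> \<ge> 1/2"
proof (rule ccontr)
  assume "\<not> ?thesis"
  then obtain i z where iz: "\<And>s. s < m \<Longrightarrow> i s < k \<and> \<bar>t (i s) - (real s + real m * real_of_int (z s))\<bar> < 1/2"
    by (metis not_le)
  have "inj_on i {..<m}"
  proof (rule inj_onI)
    fix s s' assume ss: "s \<in> {..<m}" "s' \<in> {..<m}" "i s = i s'"
    have "\<bar>t (i s) - (real s + real m * real_of_int (z s))\<bar> < 1/2"
        "\<bar>t (i s) - (real s' + real m * real_of_int (z s'))\<bar> < 1/2"
      using iz[of s] iz[of s'] ss by auto
    then have "\<bar>(real s + real m * real_of_int (z s)) - (real s' + real m * real_of_int (z s'))\<bar> < 1"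
      by linarith
    then have "\<bar>real_of_int ((int s + int m * z s) - (int s' + int m * z s'))\<bar> < 1"
      by simp
    then have "int s + int m * z s = int s' + int m * z s'" by linarith
    then have "(int s + int m * z s) mod int m = (int s' + int m * z s') mod int m" by simp
    then show "s = s'" using ss by simp
  qed
  moreover have "i ` {..<m} \<subseteq> {..<k}" using iz by auto
  ultimately have "card {..<m} \<le> card {..<k}" by (intro card_inj_on_le) auto
  then show False using assms by simp
qed

text \<open>This says that the image of a compact set of dimension at most \<open>k\<close> can be pushed off the
  origin of a real vector space of dimension \<open>m > k\<close>. On the union \<open>G s\<close> of the shrunken cubes of
  the \<open>s\<close>-th grid, the function \<open>f s\<close> is replaced by a locally constant \<open>h s\<close> that never vanishes,
  and Tietze's theorem extends the small difference. As the sets \<open>G s\<close> cover the space, some \<open>g s\<close> is nonzero at each point.\<close>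

lemma approximate_without_common_zero:
  fixes u f :: "nat \<Rightarrow> 'a \<Rightarrow> real"
  assumes C: "compact_space C" "Hausdorff_space C"
    and u: "\<And>i. i < k \<Longrightarrow> continuous_map C euclideanreal (u i)"
    and sep: "\<And>x y. \<lbrakk>x \<in> topspace C; y \<in> topspace C; \<And>i. i < k \<Longrightarrow> u i x = u i y\<rbrakk> \<Longrightarrow> x = y"
    and f: "\<And>s. s < m \<Longrightarrow> continuous_map C euclideanreal (f s)"
    and "k < m" and "\<epsilon> > 0"
  shows "\<exists>g. (\<forall>s<m. continuous_map C euclideanreal (g s)) \<and>
    (\<forall>s<m. \<forall>x\<in>topspace C. \<bar>g s x - f s x\<bar> \<le> \<epsilon>) \<and> (\<forall>x\<in>topspace C. \<exists>s<m. g s x \<noteq> 0)"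
proof -
  have "normal_space C"
    using C by (simp add: compact_Hausdorff_or_regular_imp_normal_space)
  obtain \<delta> where "\<delta> > 0" and \<delta>: "\<And>x y s. \<lbrakk>x \<in> topspace C; y \<in> topspace C; s < m;
      \<And>i. i < k \<Longrightarrow> \<bar>u i x - u i y\<bar> < \<delta>\<rbrakk> \<Longrightarrow> \<bar>f s x - f s y\<bar> < \<epsilon> / 2"
    using separating_functions_modulus[of C k u m f "\<epsilon> / 2"] C u sep f \<open>\<epsilon> > 0\<close>
    by (auto simp: Ball_def)
  \<comment> \<open>The coordinates are rescaled so that the cubes, whose side is \<open>m\<close> in the scale of \<open>t\<close>, have side \<open>\<delta>\<close> in that of \<open>u\<close>.\<close>
  define t where "t = (\<lambda>i x. m / \<delta> * u i x)"
  define G where "G = (\<lambda>s. {x \<in> topspace C. \<forall>i<k. \<forall>z::int. \<bar>t i x - (real s + real m * z)\<bar> \<ge> 1/2})"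
  \<comment> \<open>\<open>j s x\<close> labels the cube of \<open>x\<close>, and \<open>c s x\<close> is a sample point that depends on this cube only.\<close>
  define j where "j = (\<lambda>s x i. if i < k then \<lfloor>(t i x - s) / m\<rfloor> else 0)"
  define c where "c = (\<lambda>s x. SOME y. y \<in> G s \<and> j s y = j s x)"
  define h where "h = (\<lambda>s x. if f s (c s x) = 0 then \<epsilon> / 2 else f s (c s x))"
  have t: "continuous_map C euclideanreal (t i)" if "i < k" for i
    unfolding t_def using u[OF that] by (rule continuous_map_real_mult_left)
  have closed_G: "closedin C (G s)" for s
  proof -
    have "closedin C {x \<in> topspace C. \<bar>t i x - (real s + real m * z)\<bar> \<in> {1/2..}}"
      if "i < k" for i and z :: int
      by (rule closedin_continuous_map_preimage[where Y = euclideanreal])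
        (auto intro!: continuous_intros t that)
    then have "closedin C (topspace C \<inter> \<Inter>((\<lambda>(i, z::int). {x \<in> topspace C. \<bar>t i x - (real s + real m * z)\<bar> \<in> {1/2..}}) ` ({..<k} \<times> UNIV)))"
      by (cases "k = 0") (auto intro!: closedin_Int closedin_INT)
    moreover have "G s = topspace C \<inter> \<Inter>((\<lambda>(i, z::int). {x \<in> topspace C. \<bar>t i x - (real s + real m * z)\<bar> \<in> {1/2..}}) ` ({..<k} \<times> UNIV))"
      by (auto simp: G_def)
    ultimately show ?thesis by simp
  qed
  have h_nz: "h s x \<noteq> 0" for s x
    using \<open>\<epsilon> > 0\<close> by (simp add: h_def)
  have h_near: "\<bar>h s x - f s x\<bar> \<le> \<epsilon>" if "x \<in> G s" "s < m" for s x
  proof -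
    have c: "c s x \<in> G s" "j s (c s x) = j s x"
      using someI[of "\<lambda>y. y \<in> G s \<and> j s y = j s x" x] that by (auto simp: c_def)
    have "\<bar>u i x - u i (c s x)\<bar> < \<delta>" if "i < k" for i
    proof -
      have "\<lfloor>(t i (c s x) - s) / m\<rfloor> = \<lfloor>(t i x - s) / m\<rfloor>"
        using fun_cong[OF c(2), of i] that by (simp add: j_def)
      then have "\<bar>(t i (c s x) - s) / m - (t i x - s) / m\<bar> < 1" by linarith
      moreover have "(t i (c s x) - s) / m - (t i x - s) / m = (u i (c s x) - u i x) / \<delta>"
        using \<open>k < m\<close> \<open>\<delta> > 0\<close> by (simp add: t_def field_simps)
      ultimately show ?thesis using \<open>\<delta> > 0\<close> by (simp add: abs_minus_commute)
    qed
    then have "\<bar>f s x - f s (c s x)\<bar> < \<epsilon> / 2"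
      using \<delta>[of x "c s x" s] c that by (auto simp: G_def)
    then show ?thesis using \<open>\<epsilon> > 0\<close> unfolding h_def by (smt (verit) field_sum_of_halves)
  qed
  have cont_h: "continuous_map (subtopology C (G s)) euclideanreal (h s)" for s
  proof (rule continuous_map_locally_constant)
    fix x assume x: "x \<in> topspace (subtopology C (G s))"
    let ?U = "topspace C \<inter> \<Inter>((\<lambda>i. {y \<in> topspace C. \<bar>t i y - t i x\<bar> \<in> {..<1}}) ` {..<k})"
    have "openin C {y \<in> topspace C. \<bar>t i y - t i x\<bar> \<in> {..<1}}" if "i < k" for i
      by (rule openin_continuous_map_preimage[where Y = euclideanreal])
        (auto intro!: continuous_intros t that)
    then have U: "openin C ?U"
      by (cases "k = 0") (auto intro!: openin_Int openin_INT2)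
    show "\<exists>U. openin (subtopology C (G s)) U \<and> x \<in> U \<and> (\<forall>y\<in>U. h s y = h s x)"
    proof (intro exI[of _ "G s \<inter> ?U"] conjI ballI)
      show "openin (subtopology C (G s)) (G s \<inter> ?U)"
        using U by (rule openin_subtopology_Int2)
      show "x \<in> G s \<inter> ?U" using x by auto
      fix y assume y: "y \<in> G s \<inter> ?U"
      have "\<lfloor>(t i y - s) / m\<rfloor> = \<lfloor>(t i x - s) / m\<rfloor>" if "i < k" for i
      proof (rule shifted_grid_floor_eq)
        show "\<bar>t i y - t i x\<bar> < 1" using y that by auto
      qed (use x y that \<open>k < m\<close> in \<open>auto simp: G_def\<close>)
      then have "j s y = j s x" by (auto simp: j_def)
      then show "h s y = h s x" by (simp add: h_def c_def)
    qed
  qed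
  have "\<exists>g. continuous_map C euclideanreal g \<and> (\<forall>x\<in>topspace C. \<bar>g x - f s x\<bar> \<le> \<epsilon>) \<and>
      (\<forall>x\<in>G s. g x \<noteq> 0)" if "s < m" for s
  proof -
    have "continuous_map (subtopology C (G s)) euclideanreal (\<lambda>x. h s x - f s x)"
      by (intro continuous_map_diff cont_h continuous_map_from_subtopology f that)
    moreover have "(\<lambda>x. h s x - f s x) ` G s \<subseteq> {-\<epsilon>..\<epsilon>}"
      using h_near that by (auto simp: abs_le_iff) (smt (verit))+
    ultimately obtain r where r: "continuous_map C euclideanreal r"
        "\<And>x. x \<in> G s \<Longrightarrow> r x = h s x - f s x" "r ` topspace C \<subseteq> {-\<epsilon>..\<epsilon>}"
      by (rule Tietze_extension_closed_real_interval[OF \<open>normal_space C\<close> closed_G])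
        (use \<open>\<epsilon> > 0\<close> in auto)
    show ?thesis
    proof (intro exI[of _ "\<lambda>x. f s x + r x"] conjI ballI)
      show "continuous_map C euclideanreal (\<lambda>x. f s x + r x)"
        by (intro continuous_map_add f that r)
      show "\<bar>f s x + r x - f s x\<bar> \<le> \<epsilon>" if "x \<in> topspace C" for x
        using r(3) that by (auto simp: abs_le_iff image_subset_iff minus_le_iff)
      show "f s x + r x \<noteq> 0" if "x \<in> G s" for x
        using r(2)[OF that] h_nz by simp
    qed
  qed
  then obtain g where g: "\<And>s. s < m \<Longrightarrow> continuous_map C euclideanreal (g s) \<and>
      (\<forall>x\<in>topspace C. \<bar>g s x - f s x\<bar> \<le> \<epsilon>) \<and> (\<forall>x\<in>G s. g s x \<noteq> 0)"
    by metis
  have "\<exists>s<m. x \<in> G s" if "x \<in> topspace C" for x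
    using exists_good_shift[OF \<open>k < m\<close>, of "\<lambda>i. t i x"] that by (auto simp: G_def)
  with g show ?thesis by (intro exI[of _ g]) blast
qed

section \<open>Extension of odd tuples without common zero\<close>

text \<open>The tuple \<open>F\<close> is moved by \<open>d - d \<circ> \<tau>\<close>, where \<open>d\<close> is supported in \<open>C\<close>: this keeps it odd, and on \<open>C\<close>
  only \<open>d\<close> is felt. On \<open>P\<close> the result is the approximation without common zero. The set \<open>L\<close> is where
  zeros have been removed before; a small \<open>d\<close> creates no new ones there, by compactness.\<close>

lemma odd_perturbation_on_patch:
  fixes u F :: "nat \<Rightarrow> 'a \<Rightarrow> real"
  assumes Z: "compact_space Z" "Hausdorff_space Z"
    and \<tau>: "continuous_map Z Z \<tau>" "\<And>x. x \<in> topspace Z \<Longrightarrow> \<tau> (\<tau> x) = x"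
    and PVC: "closedin Z P" "P \<subseteq> V" "openin Z V" "V \<subseteq> C" "closedin Z C"
    and disj: "\<And>x. x \<in> C \<Longrightarrow> \<tau> x \<notin> C"
    and u: "\<And>i. i < k \<Longrightarrow> continuous_map (subtopology Z C) euclideanreal (u i)"
    and sep: "\<And>x y. \<lbrakk>x \<in> C; y \<in> C; \<And>i. i < k \<Longrightarrow> u i x = u i y\<rbrakk> \<Longrightarrow> x = y"
    and "k < m"
    and F: "\<And>s. s < m \<Longrightarrow> continuous_map Z euclideanreal (F s)"
    and odd: "\<And>s x. \<lbrakk>s < m; x \<in> topspace Z\<rbrakk> \<Longrightarrow> F s (\<tau> x) = - F s x"
    and L: "closedin Z L" "\<And>x. x \<in> L \<Longrightarrow> \<exists>s<m. F s x \<noteq> 0"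
  shows "\<exists>G. (\<forall>s<m. continuous_map Z euclideanreal (G s)) \<and>
    (\<forall>s<m. \<forall>x\<in>topspace Z. G s (\<tau> x) = - G s x) \<and>
    (\<forall>x\<in>L \<union> P. \<exists>s<m. G s x \<noteq> 0) \<and>
    (\<forall>s<m. \<forall>x\<in>topspace Z. x \<notin> C \<longrightarrow> \<tau> x \<notin> C \<longrightarrow> G s x = F s x)"
proof -
  have "normal_space Z"
    using Z by (simp add: compact_Hausdorff_or_regular_imp_normal_space)
  have \<tau>Z: "\<tau> x \<in> topspace Z" if "x \<in> topspace Z" for x
    using continuous_map_image_subset_topspace[OF \<tau>(1)] that by blast
  have CZ: "C \<subseteq> topspace Z" using PVC closedin_subset by blast
  have "compactin Z L" using Z L closedin_compact_space by blast
  moreover have "continuous_map (subtopology Z L) euclideanreal (\<lambda>x. \<Sum>s<m. \<bar>F s x\<bar>)"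
    by (intro continuous_map_sum continuous_map_real_abs continuous_map_from_subtopology F) auto
  moreover have "(\<Sum>s<m. \<bar>F s x\<bar>) > 0" if "x \<in> L" for x
    using L(2)[OF that] by (auto intro!: sum_pos2)
  ultimately obtain \<delta> where "\<delta> > 0" and \<delta>: "\<And>x. x \<in> L \<Longrightarrow> \<delta> \<le> (\<Sum>s<m. \<bar>F s x\<bar>)"
    using continuous_positive_bounded_below[of Z L] by blast
  \<comment> \<open>Each of the \<open>m\<close> functions moves by at most \<open>2 * \<epsilon>\<close>, and \<open>2 * m * \<epsilon> < \<delta>\<close>.\<close>
  define \<epsilon> where "\<epsilon> = \<delta> / (2 * m + 1)"
  have "\<epsilon> > 0" using \<open>\<delta> > 0\<close> by (simp add: \<epsilon>_def)
  have topC: "topspace (subtopology Z C) = C" using CZ by auto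
  have "\<exists>g. (\<forall>s<m. continuous_map (subtopology Z C) euclideanreal (g s)) \<and>
    (\<forall>s<m. \<forall>x\<in>topspace (subtopology Z C). \<bar>g s x - F s x\<bar> \<le> \<epsilon>) \<and>
    (\<forall>x\<in>topspace (subtopology Z C). \<exists>s<m. g s x \<noteq> 0)"
  proof (rule approximate_without_common_zero[where u = u and k = k])
    show "compact_space (subtopology Z C)"
      using closedin_compact_space[OF Z(1) PVC(5)] by (simp add: compact_space_subtopology)
    show "Hausdorff_space (subtopology Z C)" using Z by (simp add: Hausdorff_space_subtopology)
    show "continuous_map (subtopology Z C) euclideanreal (F s)" if "s < m" for s
      by (intro continuous_map_from_subtopology F that)
    show "x = y" if "x \<in> topspace (subtopology Z C)" "y \<in> topspace (subtopology Z C)"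
      "\<And>i. i < k \<Longrightarrow> u i x = u i y" for x y
      using that topC sep by blast
  qed (use u \<open>k < m\<close> \<open>\<epsilon> > 0\<close> in auto)
  then obtain g where g: "\<And>s. s < m \<Longrightarrow> continuous_map (subtopology Z C) euclideanreal (g s)"
      "\<And>s x. s < m \<Longrightarrow> x \<in> C \<Longrightarrow> \<bar>g s x - F s x\<bar> \<le> \<epsilon>"
      "\<And>x. x \<in> C \<Longrightarrow> \<exists>s<m. g s x \<noteq> 0"
    unfolding topC by blast
  have "\<exists>r. continuous_map Z euclideanreal r \<and> (\<forall>x\<in>C. r x = g s x - F s x) \<and>
      (\<forall>x\<in>topspace Z. \<bar>r x\<bar> \<le> \<epsilon>)" if "s < m" for s
  proof -
    have "continuous_map (subtopology Z C) euclideanreal (\<lambda>x. g s x - F s x)"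
      by (intro continuous_map_diff g continuous_map_from_subtopology F that)
    moreover have "(\<lambda>x. g s x - F s x) ` C \<subseteq> {-\<epsilon>..\<epsilon>}"
      using g(2)[OF that] by (force simp: abs_le_iff)
    ultimately obtain r where "continuous_map Z euclideanreal r"
        "\<And>x. x \<in> C \<Longrightarrow> r x = g s x - F s x" "r ` topspace Z \<subseteq> {-\<epsilon>..\<epsilon>}"
      by (rule Tietze_extension_closed_real_interval[OF \<open>normal_space Z\<close> PVC(5)])
        (use \<open>\<epsilon> > 0\<close> in auto)
    then show ?thesis by (intro exI[of _ r]) (auto simp: abs_le_iff image_subset_iff minus_le_iff)
  qed
  then obtain r where r: "\<And>s. s < m \<Longrightarrow> continuous_map Z euclideanreal (r s)"
      "\<And>s x. s < m \<Longrightarrow> x \<in> C \<Longrightarrow> r s x = g s x - F s x"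
      "\<And>s x. s < m \<Longrightarrow> x \<in> topspace Z \<Longrightarrow> \<bar>r s x\<bar> \<le> \<epsilon>"
    by metis
  obtain \<eta> where \<eta>: "continuous_map Z (top_of_set {0..1::real}) \<eta>"
      "\<eta> ` (topspace Z - V) \<subseteq> {0}" "\<eta> ` P \<subseteq> {1}"
    by (rule Urysohn_lemma[OF \<open>normal_space Z\<close>, of "topspace Z - V" P 0 1])
      (use PVC in \<open>auto simp: disjnt_def\<close>)
  have \<eta>': "continuous_map Z euclideanreal \<eta>" "\<And>x. x \<in> topspace Z \<Longrightarrow> 0 \<le> \<eta> x \<and> \<eta> x \<le> 1"
    using \<eta>(1) by (auto simp: continuous_map_in_subtopology)
  define d where "d = (\<lambda>s x. \<eta> x * r s x)"
  define G where "G = (\<lambda>s x. F s x + d s x - d s (\<tau> x))"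
  have d: "continuous_map Z euclideanreal (d s)" if "s < m" for s
    unfolding d_def by (intro continuous_map_real_mult \<eta>' r that)
  have d0: "d s x = 0" if "x \<in> topspace Z" "x \<notin> C" for s x
    using \<eta>(2) that PVC(4) by (auto simp: d_def)
  have d_le: "\<bar>d s x\<bar> \<le> \<epsilon>" if "s < m" "x \<in> topspace Z" for s x
  proof -
    have "\<bar>d s x\<bar> \<le> 1 * \<epsilon>"
      unfolding d_def abs_mult using \<eta>'(2) r(3) that by (intro mult_mono) auto
    then show ?thesis by simp
  qed
  have "\<exists>s<m. G s x \<noteq> 0" if "x \<in> L" for x
  proof (rule ccontr)
    assume "\<not> ?thesis"
    then have F0: "F s x = d s (\<tau> x) - d s x" if "s < m" for s
      using that by (auto simp: G_def)
    have "x \<in> topspace Z" using that L(1) closedin_subset by blast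
    have "\<delta> \<le> (\<Sum>s<m. \<bar>F s x\<bar>)" using \<delta> that by blast
    also have "\<dots> \<le> (\<Sum>s<m. 2 * \<epsilon>)"
    proof (rule sum_mono)
      fix s assume "s \<in> {..<m}"
      then show "\<bar>F s x\<bar> \<le> 2 * \<epsilon>"
        using F0[of s] d_le[of s x] d_le[of s "\<tau> x"] \<open>x \<in> topspace Z\<close> \<tau>Z by force
    qed
    also have "\<dots> < \<delta>" using \<open>\<delta> > 0\<close> by (simp add: \<epsilon>_def field_simps)
    finally show False by simp
  qed
  moreover have "\<exists>s<m. G s x \<noteq> 0" if "x \<in> P" for x
  proof -
    have "x \<in> C" using that PVC by blast
    then obtain s where s: "s < m" "g s x \<noteq> 0" using g(3) by blast
    have "d s (\<tau> x) = 0" using d0 disj \<open>x \<in> C\<close> CZ \<tau>Z by blast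
    moreover have "d s x = g s x - F s x"
      using \<eta>(3) that r(2) s(1) \<open>x \<in> C\<close> by (force simp: d_def)
    ultimately show ?thesis using s by (auto simp: G_def)
  qed
  moreover have "continuous_map Z euclideanreal (G s)" if "s < m" for s
    unfolding G_def
    by (intro continuous_map_diff continuous_map_add F d that
        continuous_map_compose[OF \<tau>(1) d, unfolded o_def])
  moreover have "G s (\<tau> x) = - G s x" if "s < m" "x \<in> topspace Z" for s x
    using that by (simp add: G_def odd \<tau>(2))
  moreover have "G s x = F s x" if "x \<in> topspace Z" "x \<notin> C" "\<tau> x \<notin> C" for s x
    using that d0 \<tau>Z by (simp add: G_def)
  ultimately show ?thesis by (intro exI[of _ G]) auto
qed

text \<open>The local coordinates express that \<open>Z - B\<close> has dimension at most \<open>k\<close>. The zeros of an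
  arbitrary odd extension form a compact set \<open>K\<close> away from \<open>B\<close>; finitely many patches around
  points of \<open>K\<close> suffice to remove them.\<close>

lemma odd_extension:
  fixes F :: "nat \<Rightarrow> 'a \<Rightarrow> real"
  assumes Z: "compact_space Z" "Hausdorff_space Z"
    and \<tau>: "continuous_map Z Z \<tau>" "\<And>x. x \<in> topspace Z \<Longrightarrow> \<tau> (\<tau> x) = x"
      "\<And>x. x \<in> topspace Z \<Longrightarrow> \<tau> x \<noteq> x"
    and B: "closedin Z B" "\<tau> ` B \<subseteq> B"
    and coord: "\<And>x. x \<in> topspace Z - B \<Longrightarrow> \<exists>W u. openin Z W \<and> x \<in> W \<and>
      (\<forall>i<k. continuous_map (subtopology Z W) euclideanreal (u i)) \<and>
      (\<forall>x\<in>W. \<forall>y\<in>W. (\<forall>i<k. u i x = u i y) \<longrightarrow> x = y)"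
    and "k < m"
    and F: "\<And>s. s < m \<Longrightarrow> continuous_map (subtopology Z B) euclideanreal (F s)"
    and odd: "\<And>s x. \<lbrakk>s < m; x \<in> B\<rbrakk> \<Longrightarrow> F s (\<tau> x) = - F s x"
    and nz: "\<And>x. x \<in> B \<Longrightarrow> \<exists>s<m. F s x \<noteq> 0"
  shows "\<exists>G. (\<forall>s<m. continuous_map Z euclideanreal (G s)) \<and>
    (\<forall>s<m. \<forall>x\<in>topspace Z. G s (\<tau> x) = - G s x) \<and>
    (\<forall>x\<in>topspace Z. \<exists>s<m. G s x \<noteq> 0) \<and>
    (\<forall>s<m. \<forall>x\<in>B. G s x = F s x)"
proof -
  have "normal_space Z" and reg: "regular_space Z"
    using Z by (simp_all add: compact_Hausdorff_or_regular_imp_normal_space compact_Hausdorff_imp_regular_space)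
  have \<tau>Z: "\<tau> x \<in> topspace Z" if "x \<in> topspace Z" for x
    using continuous_map_image_subset_topspace[OF \<tau>(1)] that by blast
  have BZ: "B \<subseteq> topspace Z" using B closedin_subset by blast
  have "\<exists>h. continuous_map Z euclideanreal h \<and> (\<forall>x\<in>B. h x = F s x)" if s: "s < m" for s
  proof -
    obtain h where "continuous_map Z euclideanreal h" "h ` topspace Z \<subseteq> UNIV" "\<And>x. x \<in> B \<Longrightarrow> h x = F s x"
      by (rule Tietze_extension_realinterval[OF \<open>normal_space Z\<close> B(1) is_interval_univ UNIV_not_empty F[OF s]]) auto
    then show ?thesis by blast
  qed
  then obtain h where h: "\<And>s. s < m \<Longrightarrow> continuous_map Z euclideanreal (h s)"
      "\<And>s x. s < m \<Longrightarrow> x \<in> B \<Longrightarrow> h s x = F s x"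
    by metis
  \<comment> \<open>Averaging makes the extension odd; on \<open>B\<close> it changes nothing.\<close>
  define H where "H = (\<lambda>s x. (h s x - h s (\<tau> x)) * (1/2))"
  have H: "continuous_map Z euclideanreal (H s)" if "s < m" for s
    unfolding H_def
    by (intro continuous_map_real_mult_right continuous_map_diff h that
        continuous_map_compose[OF \<tau>(1) h(1), unfolded o_def])
  have Hodd: "H s (\<tau> x) = - H s x" if "x \<in> topspace Z" for s x
    using that by (simp add: H_def \<tau>(2) field_simps)
  have HB: "H s x = F s x" if "s < m" "x \<in> B" for s x
    using that B(2) h(2) odd by (auto simp: H_def image_subset_iff)
  define K where "K = topspace Z \<inter> \<Inter>((\<lambda>s. {x \<in> topspace Z. H s x \<in> {0}}) ` {..<m})"
  have "closedin Z {x \<in> topspace Z. H s x \<in> {0}}" if "s < m" for s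
    by (rule closedin_continuous_map_preimage[OF H[OF that]]) simp
  then have "closedin Z K"
    unfolding K_def using \<open>k < m\<close> by (auto intro!: closedin_Int closedin_INT)
  then have "compactin Z K" using Z closedin_compact_space by blast
  have KB: "x \<in> topspace Z - B" if "x \<in> K" for x
    using that nz HB by (fastforce simp: K_def)
  \<comment> \<open>Nested neighbourhoods \<open>U \<subseteq> P \<subseteq> V \<subseteq> C\<close> of \<open>x\<close>: the sets \<open>U\<close> will cover \<open>K\<close>, zeros are removed on \<open>P\<close>, and \<open>V\<close> leaves room for a bump function supported in the patch \<open>C\<close>.\<close>
  define good where "good = (\<lambda>x U P V C (u :: nat \<Rightarrow> 'a \<Rightarrow> real). openin Z U \<and> x \<in> U \<and> U \<subseteq> P \<and>
      closedin Z P \<and> P \<subseteq> V \<and> openin Z V \<and> V \<subseteq> C \<and> closedin Z C \<and> C \<inter> B = {} \<and> (\<forall>x\<in>C. \<tau> x \<notin> C) \<and>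
      (\<forall>i<k. continuous_map (subtopology Z C) euclideanreal (u i)) \<and>
      (\<forall>x\<in>C. \<forall>y\<in>C. (\<forall>i<k. u i x = u i y) \<longrightarrow> x = y))"
  have "\<exists>U P V C u. good x U P V C u" if "x \<in> K" for x
  proof -
    have x: "x \<in> topspace Z" "\<tau> x \<in> topspace Z" "x \<notin> B" and xB: "x \<in> topspace Z - B"
      using KB that \<tau>Z by auto
    obtain W u where W: "openin Z W" "x \<in> W"
        "\<And>i. i < k \<Longrightarrow> continuous_map (subtopology Z W) euclideanreal (u i)"
        "\<forall>x\<in>W. \<forall>y\<in>W. (\<forall>i<k. u i x = u i y) \<longrightarrow> x = y"
      using coord[OF xB] by blast
    obtain M N where MN: "openin Z M" "openin Z N" "x \<in> M" "\<tau> x \<in> N" "disjnt M N"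
      using Z(2) x \<tau>(3)[of x] unfolding Hausdorff_space_def by metis
    define Q where "Q = (W - B) \<inter> (M \<inter> {y \<in> topspace Z. \<tau> y \<in> N})"
    have "openin Z Q"
      unfolding Q_def
      by (intro openin_Int openin_diff W B MN openin_continuous_map_preimage[OF \<tau>(1)])
    moreover have "x \<in> Q" using W MN x by (auto simp: Q_def)
    moreover have nb: "\<exists>U V. openin Z U \<and> closedin Z V \<and> x \<in> U \<and> U \<subseteq> V \<and> V \<subseteq> Q'"
      if "openin Z Q'" "x \<in> Q'" for Q'
      using reg that unfolding neighbourhood_base_of_closedin[symmetric] neighbourhood_base_of
      by blast
    ultimately obtain V C where VC: "openin Z V" "closedin Z C" "x \<in> V" "V \<subseteq> C" "C \<subseteq> Q" by metis
    obtain U P where UP: "openin Z U" "closedin Z P" "x \<in> U" "U \<subseteq> P" "P \<subseteq> V"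
      using nb[OF VC(1,3)] by blast
    have CW: "C \<subseteq> W" and CB: "C \<inter> B = {}" and disj: "\<forall>x\<in>C. \<tau> x \<notin> C"
      using VC(5) MN(5) by (auto simp: Q_def disjnt_iff)
    have "\<forall>i<k. continuous_map (subtopology Z C) euclideanreal (u i)"
      using continuous_map_from_subtopology_mono[OF W(3) CW] by blast
    moreover have "\<forall>x\<in>C. \<forall>y\<in>C. (\<forall>i<k. u i x = u i y) \<longrightarrow> x = y"
      using CW W(4) by (meson subsetD)
    ultimately have "good x U P V C u"
      unfolding good_def using UP VC(1,2,4) CB disj by (intro conjI)
    then show ?thesis by blast
  qed
  then obtain U P V C u where "\<And>x. x \<in> K \<Longrightarrow> good x (U x) (P x) (V x) (C x) (u x)"
    by metis
  then have patch: "\<And>x. x \<in> K \<Longrightarrow>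
      openin Z (U x) \<and> x \<in> U x \<and> U x \<subseteq> P x \<and> closedin Z (P x) \<and> P x \<subseteq> V x \<and> openin Z (V x) \<and> V x \<subseteq> C x \<and>
      closedin Z (C x) \<and> C x \<inter> B = {} \<and> (\<forall>y\<in>C x. \<tau> y \<notin> C x) \<and>
      (\<forall>i<k. continuous_map (subtopology Z (C x)) euclideanreal (u x i)) \<and>
      (\<forall>y\<in>C x. \<forall>z\<in>C x. (\<forall>i<k. u x i y = u x i z) \<longrightarrow> y = z)"
    unfolding good_def .
  have UK: "openin Z (U x)" "x \<in> U x" "U x \<subseteq> P x" "closedin Z (P x)" if "x \<in> K" for x
    using patch[OF that] by simp_all
  have "\<exists>\<F>. finite \<F> \<and> \<F> \<subseteq> U ` K \<and> K \<subseteq> \<Union>\<F>"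
  proof (rule compactinD[OF \<open>compactin Z K\<close>])
    show "openin Z W" if "W \<in> U ` K" for W using that UK(1) by auto
    show "K \<subseteq> \<Union>(U ` K)" using UK(2) by auto
  qed
  then obtain I where I: "finite I" "I \<subseteq> K" "K \<subseteq> \<Union>(U ` I)"
    by (metis finite_subset_image)
  define L where "L = topspace Z - \<Union>(U ` I)"
  have "closedin Z L" unfolding L_def using I UK by (intro closedin_diff openin_Union) auto
  have HL: "\<exists>s<m. H s x \<noteq> 0" if "x \<in> L" for x
    using that I(3) by (auto simp: K_def L_def)
  have "\<exists>G. (\<forall>s<m. continuous_map Z euclideanreal (G s)) \<and>
    (\<forall>s<m. \<forall>x\<in>topspace Z. G s (\<tau> x) = - G s x) \<and>
    (\<forall>x\<in>L \<union> \<Union>(P ` J). \<exists>s<m. G s x \<noteq> 0) \<and>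
    (\<forall>s<m. \<forall>x\<in>B. G s x = F s x)" if "J \<subseteq> I" for J
    using finite_subset[OF that I(1)] that
  proof (induction J rule: finite_induct)
    case empty
    then show ?case using H Hodd HL HB by (intro exI[of _ H]) auto
  next
    case (insert x J)
    have "J \<subseteq> I" using insert.prems by simp
    from insert.IH[OF this] obtain G where G: "\<forall>s<m. continuous_map Z euclideanreal (G s)"
        "\<forall>s<m. \<forall>x\<in>topspace Z. G s (\<tau> x) = - G s x"
        "\<forall>x\<in>L \<union> \<Union>(P ` J). \<exists>s<m. G s x \<noteq> 0" "\<forall>s<m. \<forall>x\<in>B. G s x = F s x"
      by (elim exE conjE)
    have xK: "x \<in> K" using insert.prems I(2) by blast
    have "closedin Z (L \<union> \<Union>(P ` J))"
      using \<open>J \<subseteq> I\<close> I(2) insert.hyps(1) UK(4) \<open>closedin Z L\<close> by (intro closedin_Un closedin_Union) auto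
    have C: "closedin Z (P x)" "P x \<subseteq> V x" "openin Z (V x)" "V x \<subseteq> C x" "closedin Z (C x)" "C x \<inter> B = {}"
      "\<And>y. y \<in> C x \<Longrightarrow> \<tau> y \<notin> C x"
      "\<And>i. i < k \<Longrightarrow> continuous_map (subtopology Z (C x)) euclideanreal (u x i)"
      "\<And>y z. \<lbrakk>y \<in> C x; z \<in> C x; \<And>i. i < k \<Longrightarrow> u x i y = u x i z\<rbrakk> \<Longrightarrow> y = z"
      using patch[OF xK] by simp_all
    have "\<exists>G'. (\<forall>s<m. continuous_map Z euclideanreal (G' s)) \<and>
      (\<forall>s<m. \<forall>x\<in>topspace Z. G' s (\<tau> x) = - G' s x) \<and>
      (\<forall>y\<in>(L \<union> \<Union>(P ` J)) \<union> P x. \<exists>s<m. G' s y \<noteq> 0) \<and>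
      (\<forall>s<m. \<forall>y\<in>topspace Z. y \<notin> C x \<longrightarrow> \<tau> y \<notin> C x \<longrightarrow> G' s y = G s y)"
      by (rule odd_perturbation_on_patch[OF Z \<tau>(1,2) C(1-5,7-9) \<open>k < m\<close>])
        (use G \<open>closedin Z (L \<union> \<Union>(P ` J))\<close> in auto)
    then obtain G' where G': "\<forall>s<m. continuous_map Z euclideanreal (G' s)"
      "\<forall>s<m. \<forall>x\<in>topspace Z. G' s (\<tau> x) = - G' s x"
      "\<forall>y\<in>(L \<union> \<Union>(P ` J)) \<union> P x. \<exists>s<m. G' s y \<noteq> 0"
      "\<forall>s<m. \<forall>y\<in>topspace Z. y \<notin> C x \<longrightarrow> \<tau> y \<notin> C x \<longrightarrow> G' s y = G s y"
      by (elim exE conjE)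
    have "G' s y = F s y" if "s < m" "y \<in> B" for s y
    proof -
      have "y \<in> topspace Z" "y \<notin> C x" "\<tau> y \<notin> C x"
        using that B(2) BZ C(6) by blast+
      then show ?thesis using G'(4) G(4) that by simp
    qed
    with G' show ?case by (intro exI[of _ G']) auto
  qed
  from this[OF order_refl] obtain G where G: "\<forall>s<m. continuous_map Z euclideanreal (G s)"
    "\<forall>s<m. \<forall>x\<in>topspace Z. G s (\<tau> x) = - G s x"
    "\<forall>x\<in>L \<union> \<Union>(P ` I). \<exists>s<m. G s x \<noteq> 0" "\<forall>s<m. \<forall>x\<in>B. G s x = F s x"
    by (elim exE conjE)
  have "topspace Z \<subseteq> L \<union> \<Union>(P ` I)"
    using I(2) UK(3) unfolding L_def by blast
  with G(3) have "\<forall>x\<in>topspace Z. \<exists>s<m. G s x \<noteq> 0" by (meson subsetD)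
  with G(1,2,4) show ?thesis by (intro exI[of _ G] conjI)
qed

section \<open>Cells and their closures\<close>

text \<open>The \<open>(k-1)\<close>-skeleton, indexed such that the induction over skeleta starts with the empty
  one at \<open>k = 0\<close>.\<close>

definition lower_cells :: "(nat \<Rightarrow> 'a set set) \<Rightarrow> nat \<Rightarrow> 'a set" where
  "lower_cells E k = (\<Union>j<k. \<Union>(E j))"

lemma in_lower_cellsE:
  assumes "x \<in> lower_cells E k"
  obtains j e where "j < k" "e \<in> E j" "x \<in> e"
  using assms unfolding lower_cells_def by blast

lemma compactin_Euclidean_space_sum_squares:
  assumes "closed T" "T \<subseteq> {..1}"
  shows "compactin (Euclidean_space k) {x \<in> topspace (Euclidean_space k). (\<Sum>i<k. (x i)\<^sup>2) \<in> T}"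
proof -
  define S where "S = {x :: nat \<Rightarrow> real. (\<forall>i\<ge>k. x i = 0) \<and> (\<Sum>i<k. (x i)\<^sup>2) \<in> T}"
  let ?Q = "\<Pi>\<^sub>E i\<in>UNIV. if i < k then {-1..1::real} else {0}"
  have "compactin (powertop_real UNIV) ?Q"
    by (auto simp: compactin_PiE)
  moreover have "S \<subseteq> ?Q"
  proof
    fix x assume x: "x \<in> S"
    have "\<bar>x i\<bar> \<le> 1" if "i < k" for i
    proof -
      have "(x i)\<^sup>2 \<le> (\<Sum>i<k. (x i)\<^sup>2)" using that by (intro member_le_sum) auto
      also have "\<dots> \<le> 1" using x assms by (auto simp: S_def)
      finally show ?thesis by (simp add: abs_square_le_1)
    qed
    then show "x \<in> ?Q" using x by (auto simp: S_def abs_le_iff minus_le_iff)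
  qed
  moreover have "closedin (powertop_real UNIV) S"
  proof -
    have "closedin (powertop_real UNIV) {x \<in> topspace (powertop_real UNIV). (\<Sum>i<k. (x i)\<^sup>2) \<in> T}"
      by (rule closedin_continuous_map_preimage[where Y = euclideanreal])
        (use assms in \<open>auto intro!: continuous_intros\<close>)
    moreover have "closedin (powertop_real UNIV) {x \<in> topspace (powertop_real UNIV). x i \<in> {0}}" for i :: nat
      by (rule closedin_continuous_map_preimage[where Y = euclideanreal]) (auto intro!: continuous_intros)
    ultimately have "closedin (powertop_real UNIV)
        ({x \<in> topspace (powertop_real UNIV). (\<Sum>i<k. (x i)\<^sup>2) \<in> T} \<inter>
         \<Inter>((\<lambda>i. {x \<in> topspace (powertop_real UNIV). x i \<in> {0}}) ` {k..}))"
      by (intro closedin_Int closedin_INT) auto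
    then show ?thesis by (rule back_subst[where P = "closedin _"]) (auto simp: S_def)
  qed
  ultimately have "compactin (powertop_real UNIV) S" using closed_compactin by blast
  then show ?thesis
    by (auto simp: Euclidean_space_def compactin_subtopology S_def)
qed

lemma connectedin_open_disc_set: "connectedin (Euclidean_space k) (open_disc_set k)"
proof -
  have "path_connected_space (subtopology (Euclidean_space k) (open_disc_set k))"
    unfolding path_connected_space_def
  proof (intro ballI)
    fix x y assume "x \<in> topspace (subtopology (Euclidean_space k) (open_disc_set k))"
      "y \<in> topspace (subtopology (Euclidean_space k) (open_disc_set k))"
    then have xy: "\<And>i. i \<ge> k \<Longrightarrow> x i = 0" "\<And>i. i \<ge> k \<Longrightarrow> y i = 0"
      "(\<Sum>i<k. (x i)\<^sup>2) < 1" "(\<Sum>i<k. (y i)\<^sup>2) < 1"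
      by (auto simp: open_disc_set_def topspace_Euclidean_space)
    define g where "g = (\<lambda>(t::real) i. (1 - t) * x i + t * y i)"
    have "(\<Sum>i<k. (g t i)\<^sup>2) < 1" if t: "0 \<le> t" "t \<le> 1" for t
    proof -
      have "(\<Sum>i<k. (g t i)\<^sup>2) \<le> (\<Sum>i<k. (1 - t) * (x i)\<^sup>2 + t * (y i)\<^sup>2)"
      proof (rule sum_mono)
        fix i
        have "(1 - t) * (x i)\<^sup>2 + t * (y i)\<^sup>2 - (g t i)\<^sup>2 = t * (1 - t) * (x i - y i)\<^sup>2"
          by (simp add: g_def power2_eq_square algebra_simps)
        moreover have "0 \<le> t * (1 - t) * (x i - y i)\<^sup>2" using t by simp
        ultimately show "(g t i)\<^sup>2 \<le> (1 - t) * (x i)\<^sup>2 + t * (y i)\<^sup>2" by linarith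
      qed
      also have "\<dots> = (1 - t) * (\<Sum>i<k. (x i)\<^sup>2) + t * (\<Sum>i<k. (y i)\<^sup>2)"
        by (simp add: sum.distrib sum_distrib_left)
      also have "\<dots> < 1" using t xy by (rule_tac convex_bound_lt) auto
      finally show ?thesis .
    qed
    then have "pathin (subtopology (Euclidean_space k) (open_disc_set k)) g"
      unfolding pathin_def continuous_map_in_subtopology Euclidean_space_def
        continuous_map_componentwise_UNIV
      by (auto simp: g_def open_disc_set_def topspace_Euclidean_space xy continuous_map_in_subtopology
        continuous_map_componentwise_UNIV intro!: continuous_intros)
    then show "\<exists>g. pathin (subtopology (Euclidean_space k) (open_disc_set k)) g \<and> g 0 = x \<and> g 1 = y"
      by (intro exI[of _ g]) (auto simp: g_def)
  qed
  then show ?thesis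
    by (auto simp: connectedin_def path_connected_imp_connected_space open_disc_set_def)
qed

context
  fixes X :: "'a topology" and E :: "nat \<Rightarrow> 'a set set"
  assumes CW: "CW_complex X E"
begin

lemma CW_Hausdorff: "Hausdorff_space X"
  and CW_Union_cells: "(\<Union>k. \<Union>(E k)) = topspace X"
  and CW_pairwise_disjoint: "\<forall>k l. \<forall>e\<in>E k. \<forall>e'\<in>E l. e \<inter> e' \<noteq> {} \<longrightarrow> k = l \<and> e = e'"
  and CW_characteristic_map: "\<forall>k. \<forall>e\<in>E k. \<exists>\<phi>. characteristic_map X E k e \<phi>"
  and CW_weak_topology: "\<forall>A. A \<subseteq> topspace X \<longrightarrow>
        (\<forall>k. \<forall>e\<in>E k. closedin X (A \<inter> X closure_of e)) \<longrightarrow> closedin X A"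
  using CW unfolding CW_complex_def by - (elim conjE, assumption)+

lemma CW_disjoint_cells: "\<lbrakk>e \<in> E k; e' \<in> E l; x \<in> e; x \<in> e'\<rbrakk> \<Longrightarrow> k = l \<and> e = e'"
  using CW_pairwise_disjoint by (metis IntI empty_iff)

lemma CW_cell_subset: "e \<in> E k \<Longrightarrow> e \<subseteq> topspace X"
  using CW_Union_cells by blast

lemma cell_disjoint_lower_cells: "\<lbrakk>e \<in> E k; l \<le> k\<rbrakk> \<Longrightarrow> e \<inter> lower_cells E l = {}"
    using CW_disjoint_cells by (metis disjoint_iff in_lower_cellsE leD)

lemma lower_cells_subset: "lower_cells E k \<subseteq> topspace X"
  using CW_cell_subset by (blast elim: in_lower_cellsE)

text \<open>What is needed of a characteristic map \<open>\<phi>\<close>. The closure of a cell is contained in the compact set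
  \<open>\<phi> ` disc_set k\<close>, which yields compactness; as \<open>\<phi> ` disc_boundary k\<close> lies in lower cells, it
  cuts out precisely the rim \<open>X closure_of e - e\<close>. The inverse of \<open>\<phi>\<close> provides coordinates on \<open>e\<close>.\<close>

lemma cell_closure:
  assumes "e \<in> E k"
  shows "compactin X (X closure_of e)" and "closedin X (X closure_of e - e)"
    and "\<exists>F. finite F \<and> F \<subseteq> (\<Union>j<k. E j) \<and> X closure_of e - e \<subseteq> \<Union>F"
    and "connectedin X e" and "e \<noteq> {}"
    and "\<exists>u. (\<forall>i<k. continuous_map (subtopology X e) euclideanreal (u i)) \<and>
      (\<forall>x\<in>e. \<forall>y\<in>e. (\<forall>i<k. u i x = u i y) \<longrightarrow> x = y)"
proof -
  obtain \<phi> F where cont: "continuous_map (subtopology (Euclidean_space k) (disc_set k)) X \<phi>"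
    and hom: "homeomorphic_map (subtopology (Euclidean_space k) (open_disc_set k)) (subtopology X e) \<phi>"
    and F: "finite F" "F \<subseteq> (\<Union>j<k. E j)" "\<phi> ` disc_boundary k \<subseteq> \<Union>F"
    using CW_characteristic_map[rule_format, OF assms] unfolding characteristic_map_def by metis
  have eX: "e \<subseteq> topspace X" using CW_cell_subset assms .
  have img: "\<phi> ` open_disc_set k = e"
    using homeomorphic_imp_surjective_map[OF hom] eX by (auto simp: open_disc_set_def Int_absorb1 Int_absorb2)
  have comp: "compactin X (\<phi> ` {x \<in> topspace (Euclidean_space k). (\<Sum>i<k. (x i)\<^sup>2) \<in> T})"
    if "closed T" "T \<subseteq> {..1}" for T
    by (rule image_compactin[OF _ cont])
      (use compactin_Euclidean_space_sum_squares[OF that] that in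
        \<open>auto simp: compactin_subtopology disc_set_def\<close>)
  have disc: "compactin X (\<phi> ` disc_set k)" and bd: "compactin X (\<phi> ` disc_boundary k)"
    using comp[of "{..1}"] comp[of "{1}"] by (simp_all add: disc_set_def disc_boundary_def)
  have "disc_set k = open_disc_set k \<union> disc_boundary k"
    by (auto simp: disc_set_def open_disc_set_def disc_boundary_def)
  then have D: "\<phi> ` disc_set k = e \<union> \<phi> ` disc_boundary k" using img by blast
  have cl: "X closure_of e \<subseteq> \<phi> ` disc_set k"
    using D compactin_imp_closedin[OF CW_Hausdorff disc] by (intro closure_of_minimal) auto
  have "\<Union>F \<subseteq> lower_cells E k" using F(2) unfolding lower_cells_def by blast
  then have "e \<inter> \<phi> ` disc_boundary k = {}"
    using F(3) cell_disjoint_lower_cells[OF assms order_refl] by blast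
  then have rim: "X closure_of e - e = X closure_of e \<inter> \<phi> ` disc_boundary k"
    using cl D by blast
  show "compactin X (X closure_of e)"
    using closed_compactin[OF disc cl] by simp
  show "closedin X (X closure_of e - e)"
    unfolding rim by (intro closedin_Int closedin_closure_of compactin_imp_closedin[OF CW_Hausdorff bd])
  show "\<exists>F. finite F \<and> F \<subseteq> (\<Union>j<k. E j) \<and> X closure_of e - e \<subseteq> \<Union>F"
  proof (intro exI[of _ F] conjI F(1,2))
    show "X closure_of e - e \<subseteq> \<Union>F" unfolding rim using F(3) by (rule le_infI2)
  qed
  have "connectedin (subtopology (Euclidean_space k) (open_disc_set k)) (open_disc_set k)"
    using connectedin_open_disc_set by (simp add: connectedin_subtopology)
  then have "connectedin (subtopology X e) e"
    using connectedin_continuous_map_image[OF homeomorphic_imp_continuous_map[OF hom]] img by metis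
  then show "connectedin X e" by (simp add: connectedin_subtopology)
  have "(\<lambda>_. 0) \<in> open_disc_set k" by (simp add: open_disc_set_def topspace_Euclidean_space)
  then show "e \<noteq> {}" using img by blast
  obtain \<psi> where \<psi>: "homeomorphic_maps (subtopology (Euclidean_space k) (open_disc_set k)) (subtopology X e) \<phi> \<psi>"
    using hom homeomorphic_map_maps by blast
  then have "continuous_map (subtopology X e) (Euclidean_space k) \<psi>"
    by (auto simp: homeomorphic_maps_def continuous_map_in_subtopology)
  then have c\<psi>: "continuous_map (subtopology X e) (powertop_real UNIV) \<psi>" and
    \<psi>0: "\<And>x i. x \<in> e \<Longrightarrow> i \<ge> k \<Longrightarrow> \<psi> x i = 0"
    using eX by (auto simp: Euclidean_space_def continuous_map_in_subtopology)
  have inv: "\<phi> (\<psi> x) = x" if "x \<in> e" for x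
    using \<psi> that eX by (auto simp: homeomorphic_maps_def)
  show "\<exists>u. (\<forall>i<k. continuous_map (subtopology X e) euclideanreal (u i)) \<and>
      (\<forall>x\<in>e. \<forall>y\<in>e. (\<forall>i<k. u i x = u i y) \<longrightarrow> x = y)"
  proof (intro exI[of _ "\<lambda>i x. \<psi> x i"] conjI allI impI ballI)
    show "continuous_map (subtopology X e) euclideanreal (\<lambda>x. \<psi> x i)" for i
      using c\<psi> by (simp add: continuous_map_componentwise_UNIV)
    fix x y assume xy: "x \<in> e" "y \<in> e" "\<forall>i<k. \<psi> x i = \<psi> y i"
    then have "\<psi> x = \<psi> y" using \<psi>0 by (metis ext not_le)
    then show "x = y" using inv xy by metis
  qed
qed

lemma closure_of_cell_minus_cell_subset:
  assumes "e \<in> E k" shows "X closure_of e - e \<subseteq> lower_cells E k"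
  using cell_closure(3)[OF assms] unfolding lower_cells_def by blast

lemma subset_closure_of_cell: "e \<in> E k \<Longrightarrow> e \<subseteq> X closure_of e"
  by (simp add: CW_cell_subset closure_of_subset)

text \<open>The weak topology also tests closures of cells of dimension at least \<open>k\<close>. Such a closure meets \<open>A\<close>
  in its rim only, hence in finitely many closures of cells of dimension less than \<open>k\<close>, by closure
  finiteness.\<close>

lemma closedin_if_closedin_on_cell_closures:
  assumes A: "A \<subseteq> lower_cells E k"
    and closed: "\<And>j e. \<lbrakk>j < k; e \<in> E j\<rbrakk> \<Longrightarrow> closedin X (A \<inter> X closure_of e)"
  shows "closedin X A"
proof -
  have "closedin X (A \<inter> X closure_of e)" if e: "e \<in> E j" for j e
  proof (cases "j < k")
    case True
    then show ?thesis using closed e by blast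
  next
    case False
    obtain F where F: "finite F" "F \<subseteq> (\<Union>i<j. E i)" "X closure_of e - e \<subseteq> \<Union>F"
      using cell_closure(3)[OF e] by blast
    define F' where "F' = {f \<in> F. f \<inter> A \<noteq> {}}"
    have F': "\<exists>i<k. f \<in> E i" if f: "f \<in> F'" for f
    proof -
      obtain x i where "f \<in> E i" "x \<in> f" "x \<in> A" using f F(2) unfolding F'_def by blast
      then show ?thesis using A CW_disjoint_cells by (metis in_lower_cellsE subsetD)
    qed
    have "A \<inter> e = {}" using False cell_disjoint_lower_cells[OF e, of k] A by auto
    have "A \<inter> X closure_of e = X closure_of e \<inter> \<Union>((\<lambda>f. A \<inter> X closure_of f) ` F')"
    proof (intro equalityI subsetI)
      fix x assume x: "x \<in> A \<inter> X closure_of e"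
      then obtain f where "f \<in> F" "x \<in> f" using F \<open>A \<inter> e = {}\<close> by blast
      then have "f \<in> F'" using x by (auto simp: F'_def)
      moreover have "x \<in> X closure_of f" using F' subset_closure_of_cell \<open>f \<in> F'\<close> \<open>x \<in> f\<close> by blast
      ultimately show "x \<in> X closure_of e \<inter> \<Union>((\<lambda>f. A \<inter> X closure_of f) ` F')" using x by blast
    qed auto
    moreover have "closedin X (\<Union>((\<lambda>f. A \<inter> X closure_of f) ` F'))"
      using F(1) F' closed by (intro closedin_Union) (auto simp: F'_def)
    ultimately show ?thesis by auto
  qed
  moreover have "A \<subseteq> topspace X" using A lower_cells_subset by blast
  ultimately show ?thesis using CW_weak_topology by simp
qed

lemma closedin_lower_cells_minus_cell:
  assumes e: "e \<in> E k"
  shows "closedin X (lower_cells E (Suc k) - e)"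
proof (rule closedin_if_closedin_on_cell_closures)
  fix j f assume j: "j < Suc k" and f: "f \<in> E j"
  have low: "X closure_of f \<subseteq> f \<union> lower_cells E j"
    using closure_of_cell_minus_cell_subset[OF f] by blast
  have f_low: "f \<subseteq> lower_cells E (Suc k)" and "lower_cells E j \<subseteq> lower_cells E (Suc k)"
    using f j unfolding lower_cells_def by (blast, force)
  moreover have "f \<inter> e = {}" if "f \<noteq> e" using CW_disjoint_cells[OF e f] that by blast
  moreover have "lower_cells E j \<inter> e = {}"
    using cell_disjoint_lower_cells[OF e, of j] j by auto
  ultimately have "(lower_cells E (Suc k) - e) \<inter> X closure_of f = X closure_of f - (if f = e then e else {})"
    using low by (cases "f = e") (simp, blast)+
  then show "closedin X ((lower_cells E (Suc k) - e) \<inter> X closure_of f)"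
    using cell_closure(2)[OF e] by auto
qed blast

lemma openin_cell:
  assumes "e \<in> E k" "e \<subseteq> Z" "Z \<subseteq> lower_cells E (Suc k)"
  shows "openin (subtopology X Z) e"
proof -
  have "openin X (topspace X - (lower_cells E (Suc k) - e))"
    using closedin_lower_cells_minus_cell[OF assms(1)] by blast
  then have "openin (subtopology X Z) (Z \<inter> (topspace X - (lower_cells E (Suc k) - e)))"
    by (rule openin_subtopology_Int2)
  then show ?thesis
    by (rule back_subst[where P = "openin _"]) (use assms CW_cell_subset in blast)
qed

end

section \<open>Cellular involutions\<close>

context
  fixes X :: "'a topology" and E :: "nat \<Rightarrow> 'a set set" and \<tau> :: "'a \<Rightarrow> 'a"
  assumes CW: "CW_complex X E"
    and \<tau>: "continuous_map X X \<tau>" "\<And>x. x \<in> topspace X \<Longrightarrow> \<tau> (\<tau> x) = x"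
    and \<tau>_low: "\<And>k. \<tau> ` lower_cells E k \<subseteq> lower_cells E k"
begin

text \<open>The image of a \<open>k\<close>-cell is connected, lies in the \<open>k\<close>-skeleton and avoids the lower cells. The
  closed sets \<open>X closure_of e'\<close> and \<open>lower_cells E (Suc k) - e'\<close> would separate it if it met the cell
  \<open>e'\<close> without being contained in it. The same applies to the image of \<open>e'\<close>, since \<open>\<tau>\<close> is its own
  inverse.\<close>

lemma involution_permutes_cells:
  assumes e: "e \<in> E k"
  shows "\<tau> ` e \<in> E k"
proof -
  have sub: "\<tau> ` e \<subseteq> e'" if e: "e \<in> E k" and e': "e' \<in> E k" and x: "x \<in> e" "\<tau> x \<in> e'" for e e' x
  proof (rule ccontr)
    assume "\<not> \<tau> ` e \<subseteq> e'"
    have eX: "e \<subseteq> topspace X" using CW_cell_subset[OF CW e] .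
    have "e \<subseteq> lower_cells E (Suc k)" using e unfolding lower_cells_def by blast
    then have low: "\<tau> ` e \<subseteq> lower_cells E (Suc k)" using \<tau>_low by blast
    have "\<tau> y \<notin> lower_cells E k" if "y \<in> e" for y
    proof
      assume "\<tau> y \<in> lower_cells E k"
      then have "\<tau> (\<tau> y) \<in> lower_cells E k" using \<tau>_low by blast
      then have "y \<in> lower_cells E k" using that eX \<tau>(2) by force
      then show False using that cell_disjoint_lower_cells[OF CW e order_refl] by blast
    qed
    then have "\<tau> ` e \<inter> (X closure_of e' - e') = {}"
      using closure_of_cell_minus_cell_subset[OF CW e'] by blast
    then have "(lower_cells E (Suc k) - e') \<inter> X closure_of e' \<inter> \<tau> ` e = {}" by blast
    moreover have "\<tau> ` e \<subseteq> (lower_cells E (Suc k) - e') \<union> X closure_of e'"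
      using low subset_closure_of_cell[OF CW e'] by blast
    moreover have "(lower_cells E (Suc k) - e') \<inter> \<tau> ` e \<noteq> {}"
      using \<open>\<not> \<tau> ` e \<subseteq> e'\<close> low by blast
    moreover have "X closure_of e' \<inter> \<tau> ` e \<noteq> {}"
      using x subset_closure_of_cell[OF CW e'] by blast
    moreover have "connectedin X (\<tau> ` e)"
      using connectedin_continuous_map_image[OF \<tau>(1) cell_closure(4)[OF CW e]] .
    ultimately show False
      using closedin_lower_cells_minus_cell[OF CW e'] unfolding connectedin_closedin
      by (metis closedin_closure_of)
  qed
  obtain x where x: "x \<in> e" using cell_closure(5)[OF CW e] by blast
  then have xX: "x \<in> topspace X" using CW_cell_subset[OF CW e] by blast
  have "x \<in> lower_cells E (Suc k)" using x e unfolding lower_cells_def by blast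
  then have "\<tau> x \<in> lower_cells E (Suc k)" using \<tau>_low by blast
  then obtain j e' where j: "j < Suc k" "e' \<in> E j" "\<tau> x \<in> e'" by (rule in_lower_cellsE)
  have "j = k"
  proof (rule ccontr)
    assume "j \<noteq> k"
    then have "j < k" using j(1) by simp
    then have "\<tau> x \<in> lower_cells E k" using j unfolding lower_cells_def by blast
    then have "\<tau> (\<tau> x) \<in> lower_cells E k" using \<tau>_low by blast
    then show False using x xX \<tau>(2) cell_disjoint_lower_cells[OF CW e order_refl] by force
  qed
  then have e': "e' \<in> E k" using j by simp
  have "\<tau> ` e \<subseteq> e'" using sub[OF e e' x j(3)] .
  moreover have "\<tau> ` e' \<subseteq> e" using sub[OF e' e j(3)] x \<tau>(2)[OF xX] by simp
  then have "e' \<subseteq> \<tau> ` e"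
    using \<tau>(2) CW_cell_subset[OF CW e'] by (metis image_subset_iff rev_image_eqI subset_eq)
  ultimately show ?thesis using e' by auto
qed

text \<open>The part of the closed orbit that lies in lower cells is covered by finitely many closures of lower
  cells, so \<open>F\<close> is continuous on it although continuity is assumed for each closure separately.\<close>

lemma odd_extension_over_orbit:
  fixes F :: "nat \<Rightarrow> 'a \<Rightarrow> real"
  assumes free: "\<And>x. x \<in> topspace X \<Longrightarrow> \<tau> x \<noteq> x"
    and e: "e \<in> E k" and "k < m"
    and F: "\<And>s j f. \<lbrakk>s < m; j < k; f \<in> E j\<rbrakk> \<Longrightarrow> continuous_map (subtopology X (X closure_of f)) euclideanreal (F s)"
    and odd: "\<And>s x. \<lbrakk>s < m; x \<in> lower_cells E k\<rbrakk> \<Longrightarrow> F s (\<tau> x) = - F s x"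
    and nz: "\<And>x. x \<in> lower_cells E k \<Longrightarrow> \<exists>s<m. F s x \<noteq> 0"
  shows "\<exists>G. (\<forall>s<m. continuous_map (subtopology X (X closure_of (e \<union> \<tau> ` e))) euclideanreal (G s)) \<and>
    (\<forall>s<m. \<forall>x\<in>X closure_of (e \<union> \<tau> ` e). G s (\<tau> x) = - G s x) \<and>
    (\<forall>x\<in>X closure_of (e \<union> \<tau> ` e). \<exists>s<m. G s x \<noteq> 0) \<and>
    (\<forall>s<m. \<forall>x\<in>X closure_of (e \<union> \<tau> ` e) \<inter> lower_cells E k. G s x = F s x)"
proof -
  define e' where "e' = \<tau> ` e"
  have e': "e' \<in> E k" using involution_permutes_cells[OF e] by (simp add: e'_def)
  have \<tau>e': "\<tau> ` e' = e" using \<tau>(2) CW_cell_subset[OF CW e] by (force simp: e'_def image_image)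
  define Z where "Z = X closure_of (e \<union> e')"
  define B where "B = Z \<inter> lower_cells E k"
  have Z: "Z = X closure_of e \<union> X closure_of e'" by (simp add: Z_def)
  have ZX: "Z \<subseteq> topspace X" unfolding Z_def by (rule closure_of_subset_topspace)
  then have topZ: "topspace (subtopology X Z) = Z" by auto
  have "compactin X Z" unfolding Z by (intro compactin_Un cell_closure(1)[OF CW e] cell_closure(1)[OF CW e'])
  have \<tau>Z: "\<tau> ` Z \<subseteq> Z"
    using continuous_map_image_closure_subset[OF \<tau>(1), of "e \<union> e'"] \<tau>e'
    by (simp add: Z_def image_Un e'_def[symmetric] Un_commute)
  have eB: "e \<inter> lower_cells E k = {}" "e' \<inter> lower_cells E k = {}"
    using cell_disjoint_lower_cells[OF CW _ order_refl] e e' by blast+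
  have rim: "X closure_of e - e \<subseteq> lower_cells E k" "X closure_of e' - e' \<subseteq> lower_cells E k"
    using closure_of_cell_minus_cell_subset[OF CW] e e' by blast+
  have B_eq: "B = (X closure_of e - e) \<union> (X closure_of e' - e')"
    using eB rim unfolding B_def Z by blast
  have "closedin X B" unfolding B_eq
    by (intro closedin_Un cell_closure(2)[OF CW e] cell_closure(2)[OF CW e'])
  have eZ: "e \<subseteq> Z" "e' \<subseteq> Z" using subset_closure_of_cell[OF CW] e e' unfolding Z by blast+
  have Zlow: "Z \<subseteq> lower_cells E (Suc k)"
    using rim e e' unfolding Z lower_cells_def by (auto simp: lessThan_Suc)
  have "\<exists>G. (\<forall>s<m. continuous_map (subtopology X Z) euclideanreal (G s)) \<and>
    (\<forall>s<m. \<forall>x\<in>topspace (subtopology X Z). G s (\<tau> x) = - G s x) \<and>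
    (\<forall>x\<in>topspace (subtopology X Z). \<exists>s<m. G s x \<noteq> 0) \<and>
    (\<forall>s<m. \<forall>x\<in>B. G s x = F s x)"
  proof (rule odd_extension[where k = k])
    show "compact_space (subtopology X Z)" using \<open>compactin X Z\<close> by (simp add: compact_space_subtopology)
    show "Hausdorff_space (subtopology X Z)" using CW_Hausdorff[OF CW] by (simp add: Hausdorff_space_subtopology)
    show "continuous_map (subtopology X Z) (subtopology X Z) \<tau>"
      using \<tau>(1) \<tau>Z ZX by (auto simp: continuous_map_in_subtopology continuous_map_from_subtopology)
    show "closedin (subtopology X Z) B"
      using \<open>closedin X B\<close> by (intro closedin_subset_topspace) (auto simp: B_def)
    show "\<tau> ` B \<subseteq> B" using \<tau>Z \<tau>_low unfolding B_def by blast
    show "\<exists>W u. openin (subtopology X Z) W \<and> x \<in> W \<and>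
      (\<forall>i<k. continuous_map (subtopology (subtopology X Z) W) euclideanreal (u i)) \<and>
      (\<forall>x\<in>W. \<forall>y\<in>W. (\<forall>i<k. u i x = u i y) \<longrightarrow> x = y)" if "x \<in> topspace (subtopology X Z) - B" for x
    proof -
      have "\<exists>c. c \<in> E k \<and> x \<in> c \<and> c \<subseteq> Z"
        using that e e' eZ unfolding B_eq Z by auto
      then obtain c where c: "c \<in> E k" "x \<in> c" "c \<subseteq> Z" by blast
      obtain u where u: "\<forall>i<k. continuous_map (subtopology X c) euclideanreal (u i)"
        "\<forall>x\<in>c. \<forall>y\<in>c. (\<forall>i<k. u i x = u i y) \<longrightarrow> x = y"
        using cell_closure(6)[OF CW c(1)] by (elim exE conjE)
      have "subtopology (subtopology X Z) c = subtopology X c"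
        using c(3) by (simp add: subtopology_subtopology Int_absorb1)
      with u c(2) openin_cell[OF CW c(1,3) Zlow] show ?thesis
        by (intro exI[of _ c] exI[of _ u] conjI) simp_all
    qed
    show "continuous_map (subtopology (subtopology X Z) B) euclideanreal (F s)" if s: "s < m" for s
    proof -
      obtain \<F>1 \<F>2 where \<F>: "finite \<F>1" "\<F>1 \<subseteq> (\<Union>j<k. E j)" "X closure_of e - e \<subseteq> \<Union>\<F>1"
          "finite \<F>2" "\<F>2 \<subseteq> (\<Union>j<k. E j)" "X closure_of e' - e' \<subseteq> \<Union>\<F>2"
        using cell_closure(3)[OF CW e] cell_closure(3)[OF CW e'] by metis
      have low: "\<exists>j<k. f \<in> E j" if "f \<in> \<F>1 \<union> \<F>2" for f
        using that \<F>(2,5) by blast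
      have "continuous_map (subtopology X B) euclideanreal (F s)"
      proof (rule pasting_lemma_closed[where I = "\<F>1 \<union> \<F>2" and T = "\<lambda>f. B \<inter> X closure_of f" and f = "\<lambda>_. F s"])
        show "finite (\<F>1 \<union> \<F>2)" using \<F> by simp
        show "closedin (subtopology X B) (B \<inter> X closure_of f)" for f
          unfolding closedin_subtopology by (intro exI[of _ "X closure_of f"]) auto
        show "continuous_map (subtopology (subtopology X B) (B \<inter> X closure_of f)) euclideanreal (F s)"
          if f: "f \<in> \<F>1 \<union> \<F>2" for f
        proof -
          obtain j where "j < k" "f \<in> E j" using low[OF f] by blast
          then show ?thesis
            using continuous_map_from_subtopology_mono[OF F[OF s], of j f "B \<inter> X closure_of f"]
            by (simp add: subtopology_subtopology)
        qed
        show "\<exists>f. f \<in> \<F>1 \<union> \<F>2 \<and> x \<in> B \<inter> X closure_of f \<and> F s x = F s x"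
          if "x \<in> topspace (subtopology X B)" for x
        proof -
          have "x \<in> B" using that by simp
          then obtain f where f: "f \<in> \<F>1 \<union> \<F>2" "x \<in> f" using \<F>(3,6) unfolding B_eq by blast
          then have "x \<in> X closure_of f" using low subset_closure_of_cell[OF CW] by blast
          with f \<open>x \<in> B\<close> show ?thesis by blast
        qed
      qed simp
      moreover have "B \<subseteq> Z" by (simp add: B_def)
      ultimately show ?thesis by (simp add: subtopology_subtopology Int_absorb1)
    qed
    show "F s (\<tau> x) = - F s x" if "s < m" "x \<in> B" for s x using odd that by (simp add: B_def)
    show "\<exists>s<m. F s x \<noteq> 0" if "x \<in> B" for x using nz that by (simp add: B_def)
  qed (use \<tau>(2) free ZX \<open>k < m\<close> in auto)
  then show ?thesis unfolding topZ unfolding B_def Z_def e'_def .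
qed

text \<open>Induction on the skeleta, with continuity only required on the closure of each cell: the weak
  topology converts this to continuity on \<open>X\<close> at the end. Extensions are chosen for orbits
  rather than cells, so that those over \<open>e\<close> and \<open>\<tau> ` e\<close> fit together to an odd map.\<close>

lemma exists_odd_nowhere_zero_functions:
  assumes free: "\<And>x. x \<in> topspace X \<Longrightarrow> \<tau> x \<noteq> x"
    and dim: "topspace X = lower_cells E m"
  shows "\<exists>F. (\<forall>s<m. continuous_map X euclideanreal (F s :: 'a \<Rightarrow> real)) \<and>
    (\<forall>s<m. \<forall>x\<in>topspace X. F s (\<tau> x) = - F s x) \<and>
    (\<forall>x\<in>topspace X. \<exists>s<m. F s x \<noteq> 0)"
proof -
  have "\<exists>F :: nat \<Rightarrow> 'a \<Rightarrow> real.
      (\<forall>s<m. \<forall>j<k. \<forall>f\<in>E j. continuous_map (subtopology X (X closure_of f)) euclideanreal (F s)) \<and>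
      (\<forall>s<m. \<forall>x\<in>lower_cells E k. F s (\<tau> x) = - F s x) \<and>
      (\<forall>x\<in>lower_cells E k. \<exists>s<m. F s x \<noteq> 0)" if "k \<le> m" for k
    using that
  proof (induction k)
    case 0
    then show ?case by (simp add: lower_cells_def)
  next
    case (Suc k)
    then have "k < m" "k \<le> m" by simp_all
    from Suc.IH[OF this(2)] obtain F :: "nat \<Rightarrow> 'a \<Rightarrow> real" where
      F: "\<forall>s<m. \<forall>j<k. \<forall>f\<in>E j. continuous_map (subtopology X (X closure_of f)) euclideanreal (F s)"
      and odd: "\<forall>s<m. \<forall>x\<in>lower_cells E k. F s (\<tau> x) = - F s x"
      and nz: "\<forall>x\<in>lower_cells E k. \<exists>s<m. F s x \<noteq> 0"
      by (elim exE conjE)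
    define good where "good = (\<lambda>Q (G :: nat \<Rightarrow> 'a \<Rightarrow> real).
      (\<forall>s<m. continuous_map (subtopology X (X closure_of Q)) euclideanreal (G s)) \<and>
      (\<forall>s<m. \<forall>x\<in>X closure_of Q. G s (\<tau> x) = - G s x) \<and>
      (\<forall>x\<in>X closure_of Q. \<exists>s<m. G s x \<noteq> 0) \<and>
      (\<forall>s<m. \<forall>x\<in>X closure_of Q \<inter> lower_cells E k. G s x = F s x))"
    have "\<exists>G. good (e \<union> \<tau> ` e) G" if e: "e \<in> E k" for e
      unfolding good_def
      by (rule odd_extension_over_orbit[OF free e \<open>k < m\<close>]) (use F odd nz in auto)
    then have "\<forall>Q\<in>(\<lambda>e. e \<union> \<tau> ` e) ` E k. \<exists>G. good Q G" by blast
    then obtain G where G: "\<And>e. e \<in> E k \<Longrightarrow> good (e \<union> \<tau> ` e) (G (e \<union> \<tau> ` e))"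
      by (metis image_eqI)
    define cell where "cell = (\<lambda>x. THE e. e \<in> E k \<and> x \<in> e)"
    have cell: "cell x = e" if "e \<in> E k" "x \<in> e" for x e
      unfolding cell_def using that CW_disjoint_cells[OF CW] by (intro the_equality) blast+
    define F' where "F' = (\<lambda>s x. if x \<in> lower_cells E k then F s x else G (cell x \<union> \<tau> ` cell x) s x)"
    have disj: "x \<notin> lower_cells E k" if "e \<in> E k" "x \<in> e" for x e
      using that cell_disjoint_lower_cells[OF CW that(1) order_refl] by blast
    have F'_cell: "F' s x = G (e \<union> \<tau> ` e) s x" if "e \<in> E k" "x \<in> e" for s x e
      using that by (simp add: F'_def disj cell)
    have F'_closure: "F' s x = G (e \<union> \<tau> ` e) s x"
      if e: "e \<in> E k" and s: "s < m" and x: "x \<in> X closure_of e" for s x e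
    proof (cases "x \<in> e")
      case False
      then have "x \<in> lower_cells E k" using closure_of_cell_minus_cell_subset[OF CW e] x by blast
      moreover have "x \<in> X closure_of (e \<union> \<tau> ` e)" using x by simp
      ultimately show ?thesis using G[OF e] s by (simp add: F'_def good_def)
    qed (use F'_cell e in blast)
    have low_Suc: "lower_cells E (Suc k) = lower_cells E k \<union> \<Union>(E k)"
      by (auto simp: lower_cells_def lessThan_Suc)
    show ?case
    proof (intro exI[of _ F'] conjI allI impI ballI)
      fix s j f assume s: "s < m" and j: "j < Suc k" and f: "f \<in> E j"
      show "continuous_map (subtopology X (X closure_of f)) euclideanreal (F' s)"
      proof (cases "j < k")
        case True
        have low: "X closure_of f \<subseteq> lower_cells E k"
          using closure_of_cell_minus_cell_subset[OF CW f] True f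
          unfolding lower_cells_def by (blast intro: less_trans)
        have "continuous_map (subtopology X (X closure_of f)) euclideanreal (F s)"
          using F s True f by blast
        then show ?thesis
          by (rule continuous_map_eq) (use low in \<open>auto simp: F'_def\<close>)
      next
        case False
        then have f: "f \<in> E k" using f j by (metis less_antisym)
        have "continuous_map (subtopology X (X closure_of (f \<union> \<tau> ` f))) euclideanreal (G (f \<union> \<tau> ` f) s)"
          using G[OF f] s by (simp add: good_def)
        then have "continuous_map (subtopology X (X closure_of f)) euclideanreal (G (f \<union> \<tau> ` f) s)"
          by (rule continuous_map_from_subtopology_mono) simp
        then show ?thesis
          by (rule continuous_map_eq) (use F'_closure[OF f s] in auto)
      qed
    next
      fix s x assume s: "s < m" and x: "x \<in> lower_cells E (Suc k)"
      show "F' s (\<tau> x) = - F' s x"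
      proof (cases "x \<in> lower_cells E k")
        case True
        then have "\<tau> x \<in> lower_cells E k" using \<tau>_low by blast
        then show ?thesis using True odd s by (simp add: F'_def)
      next
        case False
        then obtain e where e: "e \<in> E k" "x \<in> e" using x low_Suc by blast
        have eX: "e \<subseteq> topspace X" using CW_cell_subset[OF CW e(1)] .
        have "\<tau> ` \<tau> ` e = e" using \<tau>(2) eX by (force simp: image_image)
        then have orbit: "\<tau> ` e \<union> \<tau> ` \<tau> ` e = e \<union> \<tau> ` e" by blast
        have "F' s (\<tau> x) = G (e \<union> \<tau> ` e) s (\<tau> x)"
          using F'_cell[OF involution_permutes_cells[OF e(1)], of "\<tau> x" s] e(2) orbit by simp
        also have "\<dots> = - G (e \<union> \<tau> ` e) s x"
          using G[OF e(1)] s e(2) subset_closure_of_cell[OF CW e(1)] by (auto simp: good_def)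
        finally show ?thesis using F'_cell[OF e] by simp
      qed
    next
      fix x assume x: "x \<in> lower_cells E (Suc k)"
      show "\<exists>s<m. F' s x \<noteq> 0"
      proof (cases "x \<in> lower_cells E k")
        case True
        then show ?thesis using nz by (simp add: F'_def)
      next
        case False
        then obtain e where e: "e \<in> E k" "x \<in> e" using x low_Suc by blast
        then have "x \<in> X closure_of (e \<union> \<tau> ` e)" using subset_closure_of_cell[OF CW e(1)] by auto
        then show ?thesis using G[OF e(1)] F'_cell[OF e] by (simp add: good_def)
      qed
    qed
  qed
  from this[OF order_refl] obtain F :: "nat \<Rightarrow> 'a \<Rightarrow> real" where
    F: "\<forall>s<m. \<forall>j<m. \<forall>f\<in>E j. continuous_map (subtopology X (X closure_of f)) euclideanreal (F s)"
    and odd: "\<forall>s<m. \<forall>x\<in>lower_cells E m. F s (\<tau> x) = - F s x"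
    and nz: "\<forall>x\<in>lower_cells E m. \<exists>s<m. F s x \<noteq> 0"
    by (elim exE conjE)
  have "continuous_map X euclideanreal (F s)" if s: "s < m" for s
    unfolding continuous_map_closedin
  proof (intro conjI allI impI)
    fix C :: "real set" assume C: "closedin euclidean C"
    show "closedin X {x \<in> topspace X. F s x \<in> C}"
    proof (rule closedin_if_closedin_on_cell_closures[OF CW])
      show "{x \<in> topspace X. F s x \<in> C} \<subseteq> lower_cells E m" using dim by auto
      fix j e assume "j < m" "e \<in> E j"
      then have "continuous_map (subtopology X (X closure_of e)) euclideanreal (F s)" using F s by blast
      from closedin_continuous_map_preimage[OF this C]
      have "closedin (subtopology X (X closure_of e)) {x \<in> topspace (subtopology X (X closure_of e)). F s x \<in> C}" .
      then have "closedin X {x \<in> topspace (subtopology X (X closure_of e)). F s x \<in> C}"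
        by (rule closedin_trans_full) simp
      then show "closedin X ({x \<in> topspace X. F s x \<in> C} \<inter> X closure_of e)"
        by (rule back_subst[where P = "closedin X"]) auto
    qed
  qed simp
  with odd nz show ?thesis unfolding dim by (intro exI[of _ F] conjI) blast+
qed

end

lemma openin_Euclidean_space_contains_cube:
  assumes "openin (Euclidean_space m) V" "v \<in> V"
  shows "\<exists>r>0. \<forall>w. (\<forall>i\<ge>m. w i = 0) \<longrightarrow> (\<forall>i<m. \<bar>w i - v i\<bar> < r) \<longrightarrow> w \<in> V"
proof -
  obtain S where S: "openin (powertop_real UNIV) S" "V = S \<inter> {x. \<forall>i\<ge>m. x i = 0}"
    using assms(1) unfolding Euclidean_space_def openin_subtopology by blast
  obtain U where U: "v \<in> Pi\<^sub>E UNIV U" "\<And>i. open (U i)" "Pi\<^sub>E UNIV U \<subseteq> S"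
    using product_topology_open_contains_basis[OF S(1), of v] assms(2) S(2) by auto
  have "\<exists>r>0. \<forall>y. \<bar>y - v i\<bar> < r \<longrightarrow> y \<in> U i" for i
    using U(1,2) open_dist[of "U i"] by (auto simp: dist_real_def PiE_iff)
  then obtain r where r: "\<And>i. r i > 0" "\<And>i y. \<bar>y - v i\<bar> < r i \<Longrightarrow> y \<in> U i" by metis
  define \<rho> where "\<rho> = Min (insert 1 (r ` {..<m}))"
  have "\<rho> > 0" using r(1) by (simp add: \<rho>_def)
  moreover have "\<rho> \<le> r i" if "i < m" for i using that by (simp add: \<rho>_def)
  moreover have "w \<in> V" if w: "\<forall>i\<ge>m. w i = 0" "\<forall>i<m. \<bar>w i - v i\<bar> < \<rho>" for w
  proof -
    have "w i \<in> U i" for i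
    proof (cases "i < m")
      case True
      then show ?thesis using r(2)[of "w i" i] w(2) \<open>\<And>i. i < m \<Longrightarrow> \<rho> \<le> r i\<close> by fastforce
    next
      case False
      then have "w i = v i" using w(1) assms(2) S(2) by simp
      then show ?thesis using U(1) by (simp add: PiE_iff)
    qed
    then have "w \<in> S" using U(3) by (auto simp: PiE_iff)
    then show ?thesis using S(2) w by blast
  qed
  ultimately show ?thesis by blast
qed

theorem lemma3p28:
  fixes n :: nat
    and X :: "'a topology" and E :: "nat \<Rightarrow> 'a set set"
    and Y :: "'b topology" and \<tau> :: "'a \<Rightarrow> 'a"
  assumes "n \<ge> 1"
    and "CW_complex X E" and "CW_dimension E n" and "path_connected_space X"
    and "topological_manifold (n + 1) Y" and "path_connected_space Y" and "topspace Y \<noteq> {}"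
    and "involution_on X \<tau>" and "cellular_map X E X E \<tau>"
    and "\<forall>x\<in>topspace X. \<tau> x \<noteq> x"
  shows "\<not> borsuk_ulam_property X \<tau> Y"
proof -
  let ?m = "n + 1"
  have CW: "CW_complex X E" by fact
  have \<tau>: "continuous_map X X \<tau>" "\<And>x. x \<in> topspace X \<Longrightarrow> \<tau> (\<tau> x) = x"
    using assms(8) by (auto simp: involution_on_def)
  have "skeleton E k = lower_cells E (Suc k)" for k
    by (simp add: skeleton_def lower_cells_def lessThan_Suc_atMost)
  then have "\<tau> ` lower_cells E (Suc k) \<subseteq> lower_cells E (Suc k)" for k
    using assms(9) by (simp add: cellular_map_def)
  then have \<tau>_low: "\<tau> ` lower_cells E k \<subseteq> lower_cells E k" for k
    by (cases k) (simp_all add: lower_cells_def)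
  have "topspace X \<subseteq> lower_cells E ?m"
  proof
    fix x assume "x \<in> topspace X"
    then obtain k e where e: "e \<in> E k" "x \<in> e" using CW_Union_cells[OF CW] by blast
    then have "\<not> k > n" using assms(3) unfolding CW_dimension_def by blast
    then have "k < ?m" by simp
    then show "x \<in> lower_cells E ?m" using e unfolding lower_cells_def by blast
  qed
  then have dim: "topspace X = lower_cells E ?m"
    using lower_cells_subset[OF CW] by blast
  obtain F :: "nat \<Rightarrow> 'a \<Rightarrow> real" where
    F: "\<forall>s<?m. continuous_map X euclideanreal (F s)"
    and odd: "\<forall>s<?m. \<forall>x\<in>topspace X. F s (\<tau> x) = - F s x"
    and nz: "\<forall>x\<in>topspace X. \<exists>s<?m. F s x \<noteq> 0"
    using exists_odd_nowhere_zero_functions[OF CW \<tau> \<tau>_low _ dim] assms(10) by blast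
  obtain y where "y \<in> topspace Y" using assms(7) by blast
  then obtain U V where U: "openin Y U" "y \<in> U" and V: "openin (Euclidean_space ?m) V"
      and UV: "subtopology Y U homeomorphic_space subtopology (Euclidean_space ?m) V"
    using assms(5) unfolding topological_manifold_def by blast
  obtain g h where gh: "homeomorphic_maps (subtopology Y U) (subtopology (Euclidean_space ?m) V) g h"
    using UV unfolding homeomorphic_space_def by blast
  have "y \<in> topspace (subtopology Y U)" using U openin_subset by auto
  then have "g y \<in> V"
    using gh by (auto simp: homeomorphic_maps_def continuous_map_in_subtopology)
  have VE: "V \<subseteq> topspace (Euclidean_space ?m)" using V openin_subset by blast
  obtain r where "r > 0" and r: "\<And>w. \<lbrakk>\<forall>i\<ge>?m. w i = 0; \<forall>i<?m. \<bar>w i - g y i\<bar> < r\<rbrakk> \<Longrightarrow> w \<in> V"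
    using openin_Euclidean_space_contains_cube[OF V \<open>g y \<in> V\<close>] by blast
  \<comment> \<open>An odd function with values in \<open>[-r/2, r/2]\<close> that vanishes only at \<open>0\<close>.\<close>
  define c where "c = (\<lambda>t. max (-1) (min 1 t) * (r / 2))"
  define p where "p = (\<lambda>x i. if i < ?m then g y i + c (F i x) else 0)"
  have c_small: "\<bar>c t\<bar> < r" for t
  proof -
    have "\<bar>c t\<bar> \<le> 1 * (r / 2)"
      unfolding c_def abs_mult using \<open>r > 0\<close> by (intro mult_mono) auto
    then show ?thesis using \<open>r > 0\<close> by simp
  qed
  have pV: "p x \<in> V" for x
    by (rule r) (simp_all add: p_def c_small)
  have cp: "continuous_map X (Euclidean_space ?m) p"
    unfolding p_def continuous_map_componentwise_Euclidean_space c_def using F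
    by (auto intro!: continuous_intros)
  have "continuous_map X (subtopology (Euclidean_space ?m) V) p"
    using cp pV by (auto simp: continuous_map_in_subtopology)
  moreover have "continuous_map (subtopology (Euclidean_space ?m) V) Y h"
    using gh by (auto simp: homeomorphic_maps_def continuous_map_in_subtopology)
  ultimately have "continuous_map X Y (h \<circ> p)" by (rule continuous_map_compose)
  moreover have "h (p (\<tau> x)) \<noteq> h (p x)" if x: "x \<in> topspace X" for x
  proof
    assume eq: "h (p (\<tau> x)) = h (p x)"
    have "g (h (p z)) = p z" for z
      using gh pV[of z] VE by (auto simp: homeomorphic_maps_def)
    then have "p (\<tau> x) = p x" using eq by metis
    then have "c (F s (\<tau> x)) = c (F s x)" if "s < ?m" for s
      using that by (auto simp: p_def dest: fun_cong[of _ _ s])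
    then have "c (- F s x) = c (F s x)" if "s < ?m" for s
      using that odd x by metis
    moreover have "t = 0" if "c (- t) = c t" for t
      using that \<open>r > 0\<close> by (auto simp: c_def max_def min_def split: if_splits)
    ultimately show False using nz x by blast
  qed
  ultimately show ?thesis unfolding borsuk_ulam_property_def by (metis comp_apply)
qed

end
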